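(* Let $(\Omega,\mathcal{H},\hat{\mathbb{E}})$ be a regular sublinear expectation space and let $\{X_k\}_{k\ge1}\subset\mathcal{H}^d$ be a $d$-dimensional stationary sequence which is $\alpha$-mixing for some $\alpha>0$ and satisfies $\hat{\mathbb{E}}[|X_1|^2]<\infty$. Let $$\Gamma_n:=\Big\{\frac1n\sum_{k=1}^n\mathbb{E}[X_k]:\ \mathbb{E}\in\Theta\Big\}\subset\mathbb{R}^d,\qquad \Gamma_*:=\bigcap_{n\ge1}\Gamma_n .$$ Then $$\lim_{n\to\infty}\mathrm{dist}\Big(\frac1n\sum_{k=1}^nX_k,\Gamma_*\Big)=0,\quad\hat{\mathbb{E}}\text{-q.s.},$$ where $\mathrm{dist}(x,\Gamma_* ):=\inf_{y\in\Gamma_*}|x-y|$. In particular, $\hat{\mathbb{E}}$-q.s., all limit points of the sequence $\{\frac1n\sum_{k=1}^nX_k\}_{n\ge1}$ are contained in $\Gamma_*$. For $d=1$, $$-\hat{\mathbb{E}}[-X_1]\le\inf_{x\in\Gamma_*}x\le\liminf_{n\to\infty}\frac1n\sum_{k=1}^nX_k\le\limsup_{n\to\infty}\frac1n\sum_{k=1}^nX_k\le\sup_{x\in\Gamma_*}x\le\hat{\mathbb{E}}[X_1],\quad\hat{\mathbb{E}}\text{-q.s.}$$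
   Context: $\Omega$ is a nonempty set and $\mathcal{H}$ is a linear space of real-valued functions on $\Omega$ that contains the constants, contains $|X|$ whenever it contains $X$, and contains $\phi(X_1,\dots,X_n)$ for all $X_1,\dots,X_n\in\mathcal{H}$ and $\phi\in C_{lip}(\mathbb{R}^n)$ (Lipschitz functions). A sublinear expectation is a functional $\hat{\mathbb{E}}:\mathcal{H}\to\mathbb{R}$ that is monotone, preserves constants, is sub-additive, and is positively homogeneous; it is a linear expectation if it is moreover linear. It is regular if $\hat{\mathbb{E}}[X_i]\to0$ whenever $X_i\in\mathcal{H}$ decrease pointwise to $0$. $\Theta$ is the set of all linear expectations $\mathbb{E}$ on $\mathcal{H}$ with $\mathbb{E}[X]\le\hat{\mathbb{E}}[X]$ for all $X\in\mathcal{H}$. If $\hat{\mathbb{E}}$ is regular, each $\mathbb{E}\in\Theta$ is given by $\mathbb{E}[X]=\int X\,dP$ for a unique probability $P$ on $(\Omega,\sigma(\mathcal{H}))$; $\mathcal{P}$ denotes the set of all these $P$, and $\hat{\mathbb{E}}[X]=\sup_{P\in\mathcal{P}}\int X\,dP$. Set $C(A)=\sup_{P\in\mathcal{P}}P(A)$ for $A\in\sigma(\mathcal{H})$. A property holds $\hat{\mathbb{E}}$-q.s. (quasi surely) if it holds on a set $A\in\sigma(\mathcal{H})$ with $C(A^c)=0$. For $X=(X^1,\dots,X^d)\in\mathcal{H}^d$, $\mathbb{E}[X]:=(\mathbb{E}[X^1],\dots,\mathbb{E}[X^d])$ and $|X|:=\sum_i|X^i|$. Writing $\hat{\mathbb{E}}[|X_1|^2]<\infty$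 presupposes $|X_1|^2\in\mathcal{H}$. Stationary: for all $n\ge1$ and indices $t,t_1,\dots,t_n\in\mathbb{N}$, $(X_{t_1},\dots,X_{t_n})$ and $(X_{t+t_1},\dots,X_{t+t_n})$ are identically distributed, i.e. $\hat{\mathbb{E}}[\psi(\cdot)]$ takes the same value on both for every Lipschitz $\psi$. $\alpha$-mixing (for a given $\alpha>0$): there exists $c_X>0$ such that for all nonempty finite $\Lambda^1,\Lambda^2\subset\mathbb{N}$ with $\max\Lambda^1\le\min\Lambda^2$ and all $\phi\in C_{lip}(\mathbb{R}^{2d})$ with Lipschitz constant $l_\phi>0$, $$\big|\hat{\mathbb{E}}[\phi(\bar X_{\Lambda^1},\bar X_{\Lambda^2})]-\hat{\mathbb{E}}\big[\hat{\mathbb{E}}[\phi(x,\bar X_{\Lambda^2})]|_{x=\bar X_{\Lambda^1}}\big]\big|\le c_Xl_\phi e^{-\alpha|\min\Lambda^2-\max\Lambda^1|},$$ where $\bar X_{\Lambda}=\frac1{|\Lambda|}\sum_{u\in\Lambda}X_u$. *)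

theory Defs
  imports "HOL-Probability.Probability"
begin

text \<open>The sample space \<open>\<Omega>\<close> is the whole (nonempty) type \<open>'a\<close>. The space \<open>H\<close> of random variables is
  a set of functions on it. Functionals on \<open>H\<close> are total HOL functions whose values
  outside \<open>H\<close> are irrelevant.\<close>

definition l1norm :: "real ^ 'd \<Rightarrow> real" where
  "l1norm x = (\<Sum>i\<in>UNIV. \<bar>x $ i\<bar>)"

text \<open>Lipschitz functions with respect to an explicitly given distance function: the norms
  here are \<open>l\<^sup>1\<close>-norms, not the Euclidean norm of the type class.\<close>

definition lipschitz_wrt :: "('b \<Rightarrow> 'b \<Rightarrow> real) \<Rightarrow> real \<Rightarrow> ('b \<Rightarrow> real) \<Rightarrow> bool" where
  "lipschitz_wrt \<delta> L \<phi> \<longleftrightarrow> (\<forall>x y. \<bar>\<phi> x - \<phi> y\<bar> \<le> L * \<delta> x y)"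

text \<open>A Lipschitz function of \<open>n\<close> arguments, with \<open>n\<close> a term variable, is a function of a sequence
  that is Lipschitz for the \<open>l\<^sup>1\<close>-distance of the first \<open>n\<close> entries. In particular it depends on
  those entries only.\<close>

definition dist_fin :: "nat \<Rightarrow> (nat \<Rightarrow> real) \<Rightarrow> (nat \<Rightarrow> real) \<Rightarrow> real" where
  "dist_fin n x y = (\<Sum>i<n. \<bar>x i - y i\<bar>)"

definition dist_fin_vec :: "nat \<Rightarrow> (nat \<Rightarrow> real ^ 'd) \<Rightarrow> (nat \<Rightarrow> real ^ 'd) \<Rightarrow> real" where
  "dist_fin_vec n x y = (\<Sum>i<n. l1norm (x i - y i))"

definition dist_pair :: "(real ^ 'd) \<times> (real ^ 'd) \<Rightarrow> (real ^ 'd) \<times> (real ^ 'd) \<Rightarrow> real" where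
  "dist_pair p q = l1norm (fst p - fst q) + l1norm (snd p - snd q)"

definition rv_space :: "('a \<Rightarrow> real) set \<Rightarrow> bool" where
  "rv_space H \<longleftrightarrow>
     (\<forall>X\<in>H. \<forall>Y\<in>H. (\<lambda>\<omega>. X \<omega> + Y \<omega>) \<in> H) \<and>
     (\<forall>X\<in>H. \<forall>c. (\<lambda>\<omega>. c * X \<omega>) \<in> H) \<and>
     (\<forall>c. (\<lambda>\<omega>. c) \<in> H) \<and>
     (\<forall>X\<in>H. (\<lambda>\<omega>. \<bar>X \<omega>\<bar>) \<in> H) \<and>
     (\<forall>n\<ge>1. \<forall>X \<phi> L. (\<forall>i<n. X i \<in> H) \<longrightarrow> lipschitz_wrt (dist_fin n) L \<phi> \<longrightarrow>
        (\<lambda>\<omega>. \<phi> (\<lambda>i. X i \<omega>)) \<in> H)"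

definition sublinear_expectation :: "('a \<Rightarrow> real) set \<Rightarrow> (('a \<Rightarrow> real) \<Rightarrow> real) \<Rightarrow> bool" where
  "sublinear_expectation H E \<longleftrightarrow>
     (\<forall>X\<in>H. \<forall>Y\<in>H. (\<forall>\<omega>. X \<omega> \<le> Y \<omega>) \<longrightarrow> E X \<le> E Y) \<and>
     (\<forall>c. E (\<lambda>\<omega>. c) = c) \<and>
     (\<forall>X\<in>H. \<forall>Y\<in>H. E (\<lambda>\<omega>. X \<omega> + Y \<omega>) \<le> E X + E Y) \<and>
     (\<forall>X\<in>H. \<forall>c\<ge>0. E (\<lambda>\<omega>. c * X \<omega>) = c * E X)"

definition linear_expectation :: "('a \<Rightarrow> real) set \<Rightarrow> (('a \<Rightarrow> real) \<Rightarrow> real) \<Rightarrow> bool" where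
  "linear_expectation H E \<longleftrightarrow> sublinear_expectation H E \<and>
     (\<forall>X\<in>H. \<forall>Y\<in>H. \<forall>a b. E (\<lambda>\<omega>. a * X \<omega> + b * Y \<omega>) = a * E X + b * E Y)"

definition regular_expectation :: "('a \<Rightarrow> real) set \<Rightarrow> (('a \<Rightarrow> real) \<Rightarrow> real) \<Rightarrow> bool" where
  "regular_expectation H E \<longleftrightarrow>
     (\<forall>X :: nat \<Rightarrow> 'a \<Rightarrow> real.
        (\<forall>i. X i \<in> H) \<longrightarrow> (\<forall>\<omega>. decseq (\<lambda>i. X i \<omega>) \<and> (\<lambda>i. X i \<omega>) \<longlonglongrightarrow> 0) \<longrightarrow>
        (\<lambda>i. E (X i)) \<longlonglongrightarrow> 0)"

definition dominated_expectations ::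
    "('a \<Rightarrow> real) set \<Rightarrow> (('a \<Rightarrow> real) \<Rightarrow> real) \<Rightarrow> (('a \<Rightarrow> real) \<Rightarrow> real) set" where
  "dominated_expectations H Ehat = {E. linear_expectation H E \<and> (\<forall>X\<in>H. E X \<le> Ehat X)}"

definition sigma_rv :: "('a \<Rightarrow> real) set \<Rightarrow> 'a set set" where
  "sigma_rv H = sigma_sets UNIV {X -` B | X B. X \<in> H \<and> B \<in> sets borel}"

text \<open>Integrability is required explicitly because the Bochner integral of a non-integrable
  function is \<open>0\<close> by convention.\<close>

definition dominated_probabilities ::
    "('a \<Rightarrow> real) set \<Rightarrow> (('a \<Rightarrow> real) \<Rightarrow> real) \<Rightarrow> 'a measure set" where
  "dominated_probabilities H Ehat =
     {P. prob_space P \<and> space P = UNIV \<and> sets P = sigma_rv H \<and>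
         (\<exists>E\<in>dominated_expectations H Ehat. \<forall>X\<in>H. integrable P X \<and> E X = integral\<^sup>L P X)}"

definition upper_capacity ::
    "('a \<Rightarrow> real) set \<Rightarrow> (('a \<Rightarrow> real) \<Rightarrow> real) \<Rightarrow> 'a set \<Rightarrow> ennreal" where
  "upper_capacity H Ehat A = (SUP P\<in>dominated_probabilities H Ehat. emeasure P A)"

definition quasi_surely ::
    "('a \<Rightarrow> real) set \<Rightarrow> (('a \<Rightarrow> real) \<Rightarrow> real) \<Rightarrow> ('a \<Rightarrow> bool) \<Rightarrow> bool" where
  "quasi_surely H Ehat Q \<longleftrightarrow>
     (\<exists>A\<in>sigma_rv H. upper_capacity H Ehat (- A) = 0 \<and> (\<forall>\<omega>\<in>A. Q \<omega>))"

text \<open>Sequences of random vectors are indexed by the positive integers: the entry at index \<open>0\<close> is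
  never used.\<close>

definition stationary ::
    "(('a \<Rightarrow> real) \<Rightarrow> real) \<Rightarrow> (nat \<Rightarrow> 'a \<Rightarrow> real ^ 'd) \<Rightarrow> bool" where
  "stationary Ehat X \<longleftrightarrow>
     (\<forall>n\<ge>1. \<forall>t\<ge>1. \<forall>s :: nat \<Rightarrow> nat. \<forall>\<psi> L.
        (\<forall>i<n. s i \<ge> 1) \<longrightarrow> lipschitz_wrt (dist_fin_vec n) L \<psi> \<longrightarrow>
        Ehat (\<lambda>\<omega>. \<psi> (\<lambda>i. X (s i) \<omega>)) = Ehat (\<lambda>\<omega>. \<psi> (\<lambda>i. X (t + s i) \<omega>)))"

definition average :: "(nat \<Rightarrow> 'a \<Rightarrow> real ^ 'd) \<Rightarrow> nat set \<Rightarrow> 'a \<Rightarrow> real ^ 'd" where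
  "average X \<Lambda> \<omega> = (1 / real (card \<Lambda>)) *\<^sub>R (\<Sum>u\<in>\<Lambda>. X u \<omega>)"

definition alpha_mixing ::
    "real \<Rightarrow> (('a \<Rightarrow> real) \<Rightarrow> real) \<Rightarrow> (nat \<Rightarrow> 'a \<Rightarrow> real ^ 'd) \<Rightarrow> bool" where
  "alpha_mixing \<alpha> Ehat X \<longleftrightarrow>
     (\<exists>c>0. \<forall>\<Lambda>1 \<Lambda>2 \<phi> L.
        finite \<Lambda>1 \<and> \<Lambda>1 \<noteq> {} \<and> \<Lambda>1 \<subseteq> {1..} \<and> finite \<Lambda>2 \<and> \<Lambda>2 \<noteq> {} \<and> \<Lambda>2 \<subseteq> {1..} \<and>
        Max \<Lambda>1 \<le> Min \<Lambda>2 \<and> L > 0 \<and> lipschitz_wrt dist_pair L \<phi> \<longrightarrow>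
        \<bar>Ehat (\<lambda>\<omega>. \<phi> (average X \<Lambda>1 \<omega>, average X \<Lambda>2 \<omega>)) -
         Ehat (\<lambda>\<omega>. Ehat (\<lambda>\<omega>'. \<phi> (average X \<Lambda>1 \<omega>, average X \<Lambda>2 \<omega>')))\<bar>
        \<le> c * L * exp (- \<alpha> * \<bar>real (Min \<Lambda>2) - real (Max \<Lambda>1)\<bar>))"

definition vec_expectation ::
    "(('a \<Rightarrow> real) \<Rightarrow> real) \<Rightarrow> ('a \<Rightarrow> real ^ 'd) \<Rightarrow> real ^ 'd" where
  "vec_expectation E X = (\<chi> i. E (\<lambda>\<omega>. X \<omega> $ i))"

definition Gamma_mean ::
    "('a \<Rightarrow> real) set \<Rightarrow> (('a \<Rightarrow> real) \<Rightarrow> real) \<Rightarrow> (nat \<Rightarrow> 'a \<Rightarrow> real ^ 'd) \<Rightarrow> nat \<Rightarrow> (real ^ 'd) set" where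
  "Gamma_mean H Ehat X n =
     {(1 / real n) *\<^sub>R (\<Sum>k=1..n. vec_expectation E (X k)) | E. E \<in> dominated_expectations H Ehat}"

definition Gamma_star ::
    "('a \<Rightarrow> real) set \<Rightarrow> (('a \<Rightarrow> real) \<Rightarrow> real) \<Rightarrow> (nat \<Rightarrow> 'a \<Rightarrow> real ^ 'd) \<Rightarrow> (real ^ 'd) set" where
  "Gamma_star H Ehat X = (\<Inter>n\<in>{1..}. Gamma_mean H Ehat X n)"

text \<open>Extended-real valued, so that the infimum over the empty set is \<open>\<infinity>\<close> and not an
  unspecified real number.\<close>

definition dist_l1 :: "real ^ 'd \<Rightarrow> (real ^ 'd) set \<Rightarrow> ereal" where
  "dist_l1 x S = (INF y\<in>S. ereal (l1norm (x - y)))"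

end

theory Submission
  imports Defs "HOL-Real_Asymp.Real_Asymp"
begin

text \<open>By Hahn-Banach, \<open>l \<in> \<Gamma>\<^sub>*\<close> iff \<open>p \<bullet> l \<le> h\<^sub>m(p) = Ehat[p \<bullet> S\<^sub>m] / m\<close> for all \<open>m \<ge> 1\<close> and all \<open>p\<close>. As
  the \<open>h\<^sub>m\<close> are continuous, it suffices that under every dominated probability and for each \<open>p\<close> of a
  countable dense set, almost surely \<open>limsup p \<bullet> S\<^sub>n / n \<le> h\<^sub>m(p)\<close>: then the means are bounded and all
  their limit points lie in \<open>\<Gamma>\<^sub>*\<close>.

  For fixed \<open>p\<close> and \<open>m\<close>, cut \<open>{1..m r\<^sup>3}\<close> into blocks of length \<open>m\<close> and sort them into \<open>r\<close> residue classes
  of \<open>r\<^sup>2\<close> blocks each. Blocks of one class are far apart, so the mixing condition, applied to a truncated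
  square of the positive part, makes the centred sums of a class behave as for independent blocks of
  nonpositive mean: their truncated second moments add up. Jensen's inequality over the classes and
  Markov's inequality give a tail bound of order \<open>1 / r\<^sup>2\<close>, and the Borel-Cantelli lemma applies. The
  gaps between consecutive values \<open>m r\<^sup>3\<close> are short enough to be filled by a second moment bound.\<close>

section \<open>Sublinear functionals\<close>

text \<open>Homogeneity is demanded only as an inequality for a > 0, which pointwise infima inherit.
  Applying it to 1/a as well recovers equality.\<close>

definition sublinear_on :: "('a \<Rightarrow> real) set \<Rightarrow> (('a \<Rightarrow> real) \<Rightarrow> real) \<Rightarrow> bool" where
  "sublinear_on V f \<longleftrightarrow>
     (\<forall>x\<in>V. \<forall>y\<in>V. f (\<lambda>\<omega>. x \<omega> + y \<omega>) \<le> f x + f y) \<and>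
     (\<forall>x\<in>V. \<forall>a>0. f (\<lambda>\<omega>. a * x \<omega>) \<le> a * f x)"

locale function_space =
  fixes V :: "('a \<Rightarrow> real) set"
  assumes zero_mem: "(\<lambda>\<omega>. 0) \<in> V"
    and add_mem: "x \<in> V \<Longrightarrow> y \<in> V \<Longrightarrow> (\<lambda>\<omega>. x \<omega> + y \<omega>) \<in> V"
    and scale_mem: "x \<in> V \<Longrightarrow> (\<lambda>\<omega>. a * x \<omega>) \<in> V"
begin

lemma uminus_mem: "x \<in> V \<Longrightarrow> (\<lambda>\<omega>. - x \<omega>) \<in> V"
  using scale_mem[of x "-1"] by simp

lemma sublinear_on_add:
  "sublinear_on V f \<Longrightarrow> x \<in> V \<Longrightarrow> y \<in> V \<Longrightarrow> f (\<lambda>\<omega>. x \<omega> + y \<omega>) \<le> f x + f y"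
  by (simp add: sublinear_on_def)

lemma sublinear_on_zero: "sublinear_on V f \<Longrightarrow> f (\<lambda>\<omega>. 0) = 0"
proof -
  assume f: "sublinear_on V f"
  have "f (\<lambda>\<omega>. 0) \<le> a * f (\<lambda>\<omega>. 0)" if "a > 0" for a
    using f zero_mem that unfolding sublinear_on_def by fastforce
  from this[of 2] this[of "1/2"] show ?thesis by simp
qed

lemma sublinear_on_scale:
  assumes "sublinear_on V f" "x \<in> V" "a \<ge> 0"
  shows "f (\<lambda>\<omega>. a * x \<omega>) = a * f x"
proof (cases "a = 0")
  case True
  then show ?thesis using sublinear_on_zero[OF assms(1)] by simp
next
  case False
  then have a: "a > 0" using assms by simp
  have "f (\<lambda>\<omega>. a * x \<omega>) \<le> a * f x"
    using assms a unfolding sublinear_on_def by blast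
  moreover have "f (\<lambda>\<omega>. inverse a * (a * x \<omega>)) \<le> inverse a * f (\<lambda>\<omega>. a * x \<omega>)"
    using assms(1) scale_mem[OF assms(2)] a unfolding sublinear_on_def by simp
  then have "f x \<le> inverse a * f (\<lambda>\<omega>. a * x \<omega>)"
    using a by (simp add: mult.assoc[symmetric])
  then have "a * f x \<le> f (\<lambda>\<omega>. a * x \<omega>)"
    using a by (simp add: field_simps)
  ultimately show ?thesis by simp
qed

lemma sublinear_on_lower:
  assumes "sublinear_on V f" "x \<in> V"
  shows "- f (\<lambda>\<omega>. - x \<omega>) \<le> f x"
  using sublinear_on_add[OF assms(1,2) uminus_mem[OF assms(2)]] sublinear_on_zero[OF assms(1)]
  by simp

text \<open>A pair \<open>(k, c)\<close> in \<open>K\<close> stands for the constraint that a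
  functional be at least \<open>c\<close> at \<open>k\<close>. The infimal convolution of
  \<open>f\<close> over these pairs is finite by \<open>Kle\<close> and sublinear because
  \<open>K\<close> is a convex cone. Taking x = -k shows that every linear functional below
  \<open>g\<close> meets all the constraints.\<close>

lemma sublinear_on_inf_cone:
  assumes f: "sublinear_on V f"
    and K0: "((\<lambda>\<omega>. 0), 0) \<in> K"
    and KV: "\<And>k c. (k, c) \<in> K \<Longrightarrow> k \<in> V"
    and Kadd: "\<And>k c k' c'. (k, c) \<in> K \<Longrightarrow> (k', c') \<in> K \<Longrightarrow> (\<lambda>\<omega>. k \<omega> + k' \<omega>, c + c') \<in> K"
    and Kscale: "\<And>k c a. (k, c) \<in> K \<Longrightarrow> a > 0 \<Longrightarrow> (\<lambda>\<omega>. a * k \<omega>, a * c) \<in> K"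
    and Kle: "\<And>k c. (k, c) \<in> K \<Longrightarrow> c \<le> f k"
  obtains g where "sublinear_on V g"
    and "\<And>x k c. x \<in> V \<Longrightarrow> (k, c) \<in> K \<Longrightarrow> g x \<le> f (\<lambda>\<omega>. x \<omega> + k \<omega>) - c"
proof -
  define g where "g x = (INF kc\<in>K. f (\<lambda>\<omega>. x \<omega> + fst kc \<omega>) - snd kc)" for x
  have low: "- f (\<lambda>\<omega>. - x \<omega>) \<le> f (\<lambda>\<omega>. x \<omega> + k \<omega>) - c" if "x \<in> V" "(k, c) \<in> K" for x k c
  proof -
    have "f (\<lambda>\<omega>. (x \<omega> + k \<omega>) + - x \<omega>) \<le> f (\<lambda>\<omega>. x \<omega> + k \<omega>) + f (\<lambda>\<omega>. - x \<omega>)"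
      using that by (intro sublinear_on_add f add_mem uminus_mem) (auto intro: KV)
    then show ?thesis using Kle[OF that(2)] by simp
  qed
  have bdd: "bdd_below ((\<lambda>kc. f (\<lambda>\<omega>. x \<omega> + fst kc \<omega>) - snd kc) ` K)" if "x \<in> V" for x
    using low[OF that] by (intro bdd_belowI2[where m = "- f (\<lambda>\<omega>. - x \<omega>)"]) auto
  have ub: "g x \<le> f (\<lambda>\<omega>. x \<omega> + k \<omega>) - c" if "x \<in> V" "(k, c) \<in> K" for x k c
    unfolding g_def using cINF_lower[OF bdd[OF that(1)] that(2)] by simp
  have glb: "b \<le> g x" if "\<And>k c. (k, c) \<in> K \<Longrightarrow> b \<le> f (\<lambda>\<omega>. x \<omega> + k \<omega>) - c" for b x
    unfolding g_def using K0 that by (intro cINF_greatest) auto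
  have "sublinear_on V g"
    unfolding sublinear_on_def
  proof (intro conjI ballI allI impI)
    fix x y assume x: "x \<in> V" and y: "y \<in> V"
    have main: "g (\<lambda>\<omega>. x \<omega> + y \<omega>) \<le> (f (\<lambda>\<omega>. x \<omega> + k \<omega>) - c) + (f (\<lambda>\<omega>. y \<omega> + k' \<omega>) - c')"
      if k: "(k, c) \<in> K" and k': "(k', c') \<in> K" for k c k' c'
    proof -
      have "g (\<lambda>\<omega>. x \<omega> + y \<omega>) \<le> f (\<lambda>\<omega>. (x \<omega> + y \<omega>) + (k \<omega> + k' \<omega>)) - (c + c')"
        by (rule ub[OF add_mem[OF x y] Kadd[OF k k']])
      also have "(\<lambda>\<omega>. (x \<omega> + y \<omega>) + (k \<omega> + k' \<omega>)) = (\<lambda>\<omega>. (x \<omega> + k \<omega>) + (y \<omega> + k' \<omega>))"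
        by (simp add: algebra_simps)
      also have "f \<dots> \<le> f (\<lambda>\<omega>. x \<omega> + k \<omega>) + f (\<lambda>\<omega>. y \<omega> + k' \<omega>)"
        using x y k k' by (intro sublinear_on_add f add_mem) (auto intro: KV)
      finally show ?thesis by simp
    qed
    have "g (\<lambda>\<omega>. x \<omega> + y \<omega>) - (f (\<lambda>\<omega>. x \<omega> + k \<omega>) - c) \<le> g y" if "(k, c) \<in> K" for k c
      using main[OF that] by (intro glb) (simp add: algebra_simps)
    then have "g (\<lambda>\<omega>. x \<omega> + y \<omega>) - g y \<le> g x"
      by (intro glb) (simp add: algebra_simps)
    then show "g (\<lambda>\<omega>. x \<omega> + y \<omega>) \<le> g x + g y" by simp
  next
    fix x and a :: real assume x: "x \<in> V" and a: "a > 0"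
    have "g (\<lambda>\<omega>. a * x \<omega>) / a \<le> g x"
    proof (rule glb)
      fix k c assume k: "(k, c) \<in> K"
      have "g (\<lambda>\<omega>. a * x \<omega>) \<le> f (\<lambda>\<omega>. a * x \<omega> + a * k \<omega>) - a * c"
        by (rule ub[OF scale_mem[OF x] Kscale[OF k a]])
      also have "f (\<lambda>\<omega>. a * x \<omega> + a * k \<omega>) = a * f (\<lambda>\<omega>. x \<omega> + k \<omega>)"
        using sublinear_on_scale[OF f add_mem[OF x KV[OF k]], of a] a by (simp add: algebra_simps)
      finally show "g (\<lambda>\<omega>. a * x \<omega>) / a \<le> f (\<lambda>\<omega>. x \<omega> + k \<omega>) - c"
        using a by (simp add: field_simps)
    qed
    then show "g (\<lambda>\<omega>. a * x \<omega>) \<le> a * g x"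
      using a by (simp add: field_simps)
  qed
  then show thesis using ub by (rule that)
qed

text \<open>No extension from subspaces is involved: Zorn's lemma yields a minimal sublinear
  functional below \<open>q\<close>, and minimality forces it to be linear.\<close>

lemma hahn_banach_below:
  assumes q: "sublinear_on V q"
  obtains f where "\<And>x. x \<in> V \<Longrightarrow> f x \<le> q x"
    and "\<And>x y a b. x \<in> V \<Longrightarrow> y \<in> V \<Longrightarrow> f (\<lambda>\<omega>. a * x \<omega> + b * y \<omega>) = a * f x + b * f y"
proof -
  define Q where "Q = {f. sublinear_on V f \<and> (\<forall>x\<in>V. f x \<le> q x)}"
  \<comment> \<open>Functionals are total, so agreement off \<open>V\<close> is built into the order
    to make it antisymmetric.\<close>
  define le where "le f g \<longleftrightarrow> (\<forall>x\<in>V. f x \<le> g x) \<and> (\<forall>x. x \<notin> V \<longrightarrow> f x = g x)"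
    for f g :: "('a \<Rightarrow> real) \<Rightarrow> real"
  have "\<exists>m\<in>Q. \<forall>a\<in>Q. le a m \<longrightarrow> a = m"
  proof (rule predicate_Zorn)
    show "partial_order_on Q (relation_of (\<lambda>f g. le g f) Q)"
    proof (rule partial_order_on_relation_ofI)
      show "le f f" for f by (simp add: le_def)
      show "le h f" if "le g f" "le h g" for f g h
        using that unfolding le_def by (metis order_trans)
      show "f = g" if "le g f" "le f g" for f g
        using that unfolding le_def by (intro ext) (meson order_antisym)
    qed
  next
    fix C assume C: "C \<in> Chains (relation_of (\<lambda>f g. le g f) Q)"
    have CQ: "C \<subseteq> Q" and tot: "\<And>f g. f \<in> C \<Longrightarrow> g \<in> C \<Longrightarrow> le f g \<or> le g f"
      using C by (auto simp: Chains_def relation_of_def)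
    show "\<exists>u\<in>Q. \<forall>a\<in>C. le u a"
    proof (cases "C = {}")
      case True
      then show ?thesis using q by (auto simp: Q_def)
    next
      case False
      then obtain f0 where f0: "f0 \<in> C" by blast
      define u where "u x = (if x \<in> V then (INF f\<in>C. f x) else f0 x)" for x
      have bdd: "bdd_below ((\<lambda>f. f x) ` C)" if "x \<in> V" for x
      proof (rule bdd_belowI2)
        fix f assume "f \<in> C"
        then have "sublinear_on V f" "f (\<lambda>\<omega>. - x \<omega>) \<le> q (\<lambda>\<omega>. - x \<omega>)"
          using CQ uminus_mem[OF that] by (auto simp: Q_def)
        then show "- q (\<lambda>\<omega>. - x \<omega>) \<le> f x"
          using sublinear_on_lower[OF _ that, of f] by simp
      qed
      have ub: "u x \<le> f x" if "x \<in> V" "f \<in> C" for x f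
        using cINF_lower[OF bdd[OF that(1)] that(2)] that by (simp add: u_def)
      have glb: "b \<le> u x" if "x \<in> V" "\<And>f. f \<in> C \<Longrightarrow> b \<le> f x" for x b
        using that False by (auto simp: u_def intro!: cINF_greatest)
      have "sublinear_on V u"
        unfolding sublinear_on_def
      proof (intro conjI ballI allI impI)
        fix x y assume x: "x \<in> V" and y: "y \<in> V"
        have main: "u (\<lambda>\<omega>. x \<omega> + y \<omega>) \<le> f x + g y" if "f \<in> C" "g \<in> C" for f g
        proof -
          \<comment> \<open>In a chain one of \<open>f\<close> and \<open>g\<close> lies below the
            other and serves as \<open>h\<close>.\<close>
          have "\<exists>h\<in>C. h x \<le> f x \<and> h y \<le> g y"
            using tot[OF that] that x y by (auto simp: le_def)
          then obtain h where h: "h \<in> C" "h x \<le> f x" "h y \<le> g y" by blast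
          have "u (\<lambda>\<omega>. x \<omega> + y \<omega>) \<le> h (\<lambda>\<omega>. x \<omega> + y \<omega>)"
            by (rule ub[OF add_mem[OF x y] h(1)])
          also have "\<dots> \<le> h x + h y"
            using h(1) CQ x y by (intro sublinear_on_add) (auto simp: Q_def)
          finally show ?thesis using h by linarith
        qed
        have "u (\<lambda>\<omega>. x \<omega> + y \<omega>) - f x \<le> u y" if "f \<in> C" for f
          using main[OF that] y by (intro glb) (auto simp: algebra_simps)
        then have "u (\<lambda>\<omega>. x \<omega> + y \<omega>) - u y \<le> u x"
          using x by (intro glb) (auto simp: algebra_simps)
        then show "u (\<lambda>\<omega>. x \<omega> + y \<omega>) \<le> u x + u y" by simp
      next
        fix x and a :: real assume x: "x \<in> V" and a: "a > 0"
        have "u (\<lambda>\<omega>. a * x \<omega>) / a \<le> u x"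
        proof (rule glb[OF x])
          fix f assume f: "f \<in> C"
          have "u (\<lambda>\<omega>. a * x \<omega>) \<le> f (\<lambda>\<omega>. a * x \<omega>)"
            by (rule ub[OF scale_mem[OF x] f])
          also have "\<dots> \<le> a * f x"
            using f CQ x a by (auto simp: Q_def sublinear_on_def)
          finally show "u (\<lambda>\<omega>. a * x \<omega>) / a \<le> f x"
            using a by (simp add: field_simps)
        qed
        then show "u (\<lambda>\<omega>. a * x \<omega>) \<le> a * u x"
          using a by (simp add: field_simps)
      qed
      moreover have "u x \<le> q x" if "x \<in> V" for x
      proof -
        have "f0 \<in> Q" using f0 CQ by (rule rev_subsetD)
        then have "f0 x \<le> q x" using that by (simp add: Q_def)
        then show ?thesis using ub[OF that f0] by linarith
      qed
      ultimately have "u \<in> Q" by (auto simp: Q_def)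
      moreover have "le u f" if "f \<in> C" for f
        using ub[OF _ that] tot[OF that f0] by (auto simp: le_def u_def)
      ultimately show ?thesis by blast
    qed
  qed
  then obtain f where f: "f \<in> Q" and min: "\<And>g. g \<in> Q \<Longrightarrow> le g f \<Longrightarrow> g = f" by blast
  have fs: "sublinear_on V f" and fq: "\<And>x. x \<in> V \<Longrightarrow> f x \<le> q x" using f by (auto simp: Q_def)
  have super: "f x + f y \<le> f (\<lambda>\<omega>. x \<omega> + y \<omega>)" if x: "x \<in> V" and y: "y \<in> V" for x y
  proof -
    \<comment> \<open>The constraint of being at least \<open>f y\<close> at \<open>y\<close>
      produces some \<open>g\<close> below \<open>f\<close>. Minimality makes both equal on
      \<open>V\<close>, and the constraint with t = 1 then reads as superadditivity.\<close>
    define K where "K = {(\<lambda>\<omega>. t * y \<omega>, t * f y) | t. t \<ge> 0}"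
    have K: "(\<lambda>\<omega>. t * y \<omega>, t * f y) \<in> K" if "t \<ge> 0" for t
      using that unfolding K_def by blast
    obtain g where g: "sublinear_on V g"
      and gle: "\<And>x k c. x \<in> V \<Longrightarrow> (k, c) \<in> K \<Longrightarrow> g x \<le> f (\<lambda>\<omega>. x \<omega> + k \<omega>) - c"
    proof (rule sublinear_on_inf_cone[OF fs, of K])
      show "(\<lambda>\<omega>. 0, 0) \<in> K" using K[of 0] by simp
      show "k \<in> V" if "(k, c) \<in> K" for k c
        using that y by (auto simp: K_def intro: scale_mem)
      show "(\<lambda>\<omega>. k \<omega> + k' \<omega>, c + c') \<in> K" if "(k, c) \<in> K" "(k', c') \<in> K" for k c k' c'
      proof -
        from that obtain t t' where "k = (\<lambda>\<omega>. t * y \<omega>)" "c = t * f y" "t \<ge> 0"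
          "k' = (\<lambda>\<omega>. t' * y \<omega>)" "c' = t' * f y" "t' \<ge> 0" by (auto simp: K_def)
        then show ?thesis using K[of "t + t'"] by (simp add: algebra_simps)
      qed
      show "(\<lambda>\<omega>. a * k \<omega>, a * c) \<in> K" if "(k, c) \<in> K" "a > 0" for k c a
      proof -
        from that obtain t where "k = (\<lambda>\<omega>. t * y \<omega>)" "c = t * f y" "t \<ge> 0"
          by (auto simp: K_def)
        then show ?thesis using K[of "a * t"] that by (simp add: algebra_simps)
      qed
      show "c \<le> f k" if "(k, c) \<in> K" for k c
        using that sublinear_on_scale[OF fs y] by (auto simp: K_def)
    qed blast
    define g' where "g' x = (if x \<in> V then g x else f x)" for x
    have "sublinear_on V g'"
      using g by (auto simp: sublinear_on_def g'_def add_mem scale_mem)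
    moreover have gf: "g' x \<le> f x" if "x \<in> V" for x
      using gle[OF that K[of 0]] that by (simp add: g'_def)
    ultimately have "g' = f"
    proof (intro min)
      assume g': "sublinear_on V g'"
      then show "g' \<in> Q" using order_trans[OF gf fq] by (simp add: Q_def)
      show "le g' f" using gf by (simp add: le_def g'_def)
    qed
    then have "g' x = f x" by simp
    then have "f x = g x" using x by (simp add: g'_def)
    then show ?thesis using gle[OF x K[of 1]] by simp
  qed
  have add: "f (\<lambda>\<omega>. x \<omega> + y \<omega>) = f x + f y" if "x \<in> V" "y \<in> V" for x y
    using super[OF that] sublinear_on_add[OF fs that] by simp
  have neg: "f (\<lambda>\<omega>. - x \<omega>) = - f x" if "x \<in> V" for x
    using add[OF that uminus_mem[OF that]] sublinear_on_zero[OF fs] by simp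
  have scale: "f (\<lambda>\<omega>. a * x \<omega>) = a * f x" if "x \<in> V" for x a
  proof (cases "a \<ge> 0")
    case True
    then show ?thesis using sublinear_on_scale[OF fs that] by simp
  next
    case False
    then show ?thesis
      using sublinear_on_scale[OF fs that, of "- a"] neg[OF scale_mem[OF that, of a]] by simp
  qed
  have "f (\<lambda>\<omega>. a * x \<omega> + b * y \<omega>) = a * f x + b * f y" if "x \<in> V" "y \<in> V" for x y a b
    using add[OF scale_mem[OF that(1)] scale_mem[OF that(2)]] scale that by simp
  with fq show thesis by (rule that)
qed

end

section \<open>Sublinear expectations and the linear expectations they dominate\<close>

locale sublinear_space =
  fixes H :: "('a \<Rightarrow> real) set" and Ehat :: "('a \<Rightarrow> real) \<Rightarrow> real"
  assumes rv: "rv_space H" and sublinear: "sublinear_expectation H Ehat"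
begin

lemma const_mem: "(\<lambda>\<omega>. c) \<in> H"
  and abs_mem: "Z \<in> H \<Longrightarrow> (\<lambda>\<omega>. \<bar>Z \<omega>\<bar>) \<in> H"
  using rv by (auto simp: rv_space_def)

sublocale function_space H
  by unfold_locales (use rv in \<open>auto simp: rv_space_def\<close>)

lemma diff_mem: "Z \<in> H \<Longrightarrow> W \<in> H \<Longrightarrow> (\<lambda>\<omega>. Z \<omega> - W \<omega>) \<in> H"
  using add_mem[OF _ uminus_mem, of Z W] by simp

lemma sum_mem: "(\<And>j. j \<in> J \<Longrightarrow> Z j \<in> H) \<Longrightarrow> (\<lambda>\<omega>. \<Sum>j\<in>J. Z j \<omega>) \<in> H"
  by (induction J rule: infinite_finite_induct) (auto intro: const_mem add_mem)

lemma lipschitz_mem: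
  assumes "Z \<in> H" and "\<And>s t. \<bar>f s - f t\<bar> \<le> L * \<bar>s - t\<bar>"
  shows "(\<lambda>\<omega>. f (Z \<omega>)) \<in> H"
proof -
  have closed: "(\<lambda>\<omega>. \<phi> (\<lambda>i. W i \<omega>)) \<in> H"
    if "n \<ge> 1" "\<And>i. i < n \<Longrightarrow> W i \<in> H" "lipschitz_wrt (dist_fin n) L \<phi>" for n W \<phi>
    using rv that unfolding rv_space_def by blast
  have "lipschitz_wrt (dist_fin 1) L (\<lambda>x. f (x 0))"
    using assms(2) by (simp add: lipschitz_wrt_def dist_fin_def)
  from closed[OF _ _ this, of "\<lambda>i. Z"] show ?thesis using assms(1) by simp
qed

lemma Ehat_mono: "Z \<in> H \<Longrightarrow> W \<in> H \<Longrightarrow> (\<And>\<omega>. Z \<omega> \<le> W \<omega>) \<Longrightarrow> Ehat Z \<le> Ehat W"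
  and Ehat_const: "Ehat (\<lambda>\<omega>. c) = c"
  and Ehat_add: "Z \<in> H \<Longrightarrow> W \<in> H \<Longrightarrow> Ehat (\<lambda>\<omega>. Z \<omega> + W \<omega>) \<le> Ehat Z + Ehat W"
  and Ehat_scale: "Z \<in> H \<Longrightarrow> a \<ge> 0 \<Longrightarrow> Ehat (\<lambda>\<omega>. a * Z \<omega>) = a * Ehat Z"
  using sublinear by (auto simp: sublinear_expectation_def)

lemma sublinear_on_Ehat: "sublinear_on H Ehat"
  by (simp add: sublinear_on_def Ehat_add Ehat_scale)

lemma Ehat_sum:
  "(\<And>j. j \<in> J \<Longrightarrow> Z j \<in> H) \<Longrightarrow> Ehat (\<lambda>\<omega>. \<Sum>j\<in>J. Z j \<omega>) \<le> (\<Sum>j\<in>J. Ehat (Z j))"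
proof (induction J rule: infinite_finite_induct)
  case (insert j J)
  have "Ehat (\<lambda>\<omega>. Z j \<omega> + (\<Sum>j\<in>J. Z j \<omega>)) \<le> Ehat (Z j) + Ehat (\<lambda>\<omega>. \<Sum>j\<in>J. Z j \<omega>)"
    using insert.prems by (intro Ehat_add sum_mem) auto
  then show ?case using insert by simp
qed (simp_all add: Ehat_const)

lemma Ehat_le_add_const:
  assumes "Z \<in> H" "W \<in> H" "\<And>\<omega>. Z \<omega> \<le> W \<omega> + c"
  shows "Ehat Z \<le> Ehat W + c"
  using Ehat_mono[OF assms(1) add_mem[OF assms(2) const_mem[of c]] assms(3)]
    Ehat_add[OF assms(2) const_mem[of c]] Ehat_const[of c] by linarith

text \<open>The constraints now form a linear subspace, one for each direction p. Those for p and -p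
  together turn lower bounds into equalities, while p = 0 keeps the functional below
  \<open>Ehat\<close>.\<close>

lemma ex_dominated_expectation:
  fixes Z :: "'a \<Rightarrow> real ^ 'd"
  assumes Z: "\<And>i. (\<lambda>\<omega>. Z \<omega> $ i) \<in> H" and l: "\<And>p. p \<bullet> l \<le> Ehat (\<lambda>\<omega>. p \<bullet> Z \<omega>)"
  obtains E where "E \<in> dominated_expectations H Ehat" and "vec_expectation E Z = l"
proof -
  have pZ: "(\<lambda>\<omega>. p \<bullet> Z \<omega>) \<in> H" for p
    unfolding inner_vec_def using Z by (auto intro!: sum_mem scale_mem)
  define K where "K = {(\<lambda>\<omega>. p \<bullet> Z \<omega>, p \<bullet> l) | p. True}"
  have K: "(\<lambda>\<omega>. p \<bullet> Z \<omega>, p \<bullet> l) \<in> K" for p unfolding K_def by blast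
  obtain g where g: "sublinear_on H g"
    and gle: "\<And>x k c. x \<in> H \<Longrightarrow> (k, c) \<in> K \<Longrightarrow> g x \<le> Ehat (\<lambda>\<omega>. x \<omega> + k \<omega>) - c"
  proof (rule sublinear_on_inf_cone[OF sublinear_on_Ehat, of K])
    show "(\<lambda>\<omega>. 0, 0) \<in> K" using K[of 0] by simp
    show "k \<in> H" if "(k, c) \<in> K" for k c
      using that pZ by (auto simp: K_def)
    show "(\<lambda>\<omega>. k \<omega> + k' \<omega>, c + c') \<in> K" if "(k, c) \<in> K" "(k', c') \<in> K" for k c k' c'
    proof -
      from that obtain p p' where "k = (\<lambda>\<omega>. p \<bullet> Z \<omega>)" "c = p \<bullet> l"
        "k' = (\<lambda>\<omega>. p' \<bullet> Z \<omega>)" "c' = p' \<bullet> l" by (auto simp: K_def)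
      then show ?thesis using K[of "p + p'"] by (simp add: inner_add_left)
    qed
    show "(\<lambda>\<omega>. a * k \<omega>, a * c) \<in> K" if "(k, c) \<in> K" "a > 0" for k c a
    proof -
      from that obtain p where "k = (\<lambda>\<omega>. p \<bullet> Z \<omega>)" "c = p \<bullet> l" by (auto simp: K_def)
      then show ?thesis using K[of "a *\<^sub>R p"] by simp
    qed
    show "c \<le> Ehat k" if "(k, c) \<in> K" for k c
      using that l by (auto simp: K_def)
  qed blast
  obtain E where Eg: "\<And>x. x \<in> H \<Longrightarrow> E x \<le> g x"
    and lin: "\<And>x y a b. x \<in> H \<Longrightarrow> y \<in> H \<Longrightarrow> E (\<lambda>\<omega>. a * x \<omega> + b * y \<omega>) = a * E x + b * E y"
    using hahn_banach_below[OF g] by blast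
  have scale: "E (\<lambda>\<omega>. a * x \<omega>) = a * E x" if "x \<in> H" for x a
    using lin[OF that that, of a 0] by simp
  have dom: "E x \<le> Ehat x" if "x \<in> H" for x
    using Eg[OF that] gle[OF that K[of 0]] by simp
  \<comment> \<open>Domination at both \<open>c\<close> and \<open>- c\<close> leaves only one
    possible value.\<close>
  have const: "E (\<lambda>\<omega>. c) = c" for c
    using dom[OF const_mem, of c] dom[OF const_mem, of "- c"] scale[OF const_mem, of "-1" c]
    by (simp add: Ehat_const)
  have mono: "E x \<le> E y" if "x \<in> H" "y \<in> H" "\<And>\<omega>. x \<omega> \<le> y \<omega>" for x y
  proof -
    have "E (\<lambda>\<omega>. x \<omega> - y \<omega>) \<le> Ehat (\<lambda>\<omega>. 0)"
      using dom[OF diff_mem[OF that(1,2)]] Ehat_mono[OF diff_mem[OF that(1,2)] const_mem[of 0]]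
        that(3) by fastforce
    then show ?thesis using lin[OF that(1,2), of 1 "-1"] by (simp add: Ehat_const)
  qed
  have "E \<in> dominated_expectations H Ehat"
    using lin[of _ _ 1 1]
    by (simp add: dominated_expectations_def linear_expectation_def sublinear_expectation_def
        lin scale dom const mono)
  moreover have "E (\<lambda>\<omega>. Z \<omega> $ i) = l $ i" for i
  proof -
    \<comment> \<open>At the negative of \<open>p \<bullet> Z\<close> the constraint for
      \<open>p\<close> cancels the argument, and \<open>Ehat\<close> of zero remains.\<close>
    have low: "p \<bullet> l \<le> E (\<lambda>\<omega>. p \<bullet> Z \<omega>)" for p
      using Eg[OF pZ[of "- p"]] gle[OF pZ[of "- p"] K[of p]] scale[OF pZ[of p], of "-1"]
      by (simp add: Ehat_const)
    show ?thesis
      using low[of "axis i 1"] low[of "- axis i 1"] scale[OF Z, of "-1" i]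
      by (simp add: inner_axis')
  qed
  then have "vec_expectation E Z = l" unfolding vec_expectation_def by (simp add: vec_eq_iff)
  ultimately show thesis by (rule that)
qed

end

section \<open>A truncated square\<close>

text \<open>The clipped parameter realises the supremum of \<open>2 s t - s\<^sup>2\<close> over \<open>0 \<le> s \<le> N\<close>: a convex
  Lipschitz substitute for \<open>(max 0 t)\<^sup>2\<close>, to which the mixing condition applies.\<close>

definition clip :: "real \<Rightarrow> real \<Rightarrow> real" where
  "clip N t = max 0 (min N t)"

definition huber :: "real \<Rightarrow> real \<Rightarrow> real" where
  "huber N t = 2 * clip N t * t - (clip N t)\<^sup>2"

lemma clip_bounds: "N \<ge> 0 \<Longrightarrow> 0 \<le> clip N t \<and> clip N t \<le> N"
  by (auto simp: clip_def)

text \<open>\<open>clip N t\<close> is the projection of \<open>t\<close> onto the interval [0, N],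
  and this is the obtuse angle criterion for projections onto convex sets.\<close>

lemma clip_projection: "0 \<le> s \<Longrightarrow> s \<le> N \<Longrightarrow> (t - clip N t) * (s - clip N t) \<le> 0"
  by (auto simp: clip_def max_def min_def mult_nonneg_nonpos mult_nonpos_nonneg)

lemma huber_ge:
  assumes "0 \<le> s" "s \<le> N"
  shows "2 * s * t - s\<^sup>2 \<le> huber N t"
proof -
  have "huber N t - (2 * s * t - s\<^sup>2)
      = (s - clip N t)\<^sup>2 - 2 * ((t - clip N t) * (s - clip N t))"
    by (simp add: huber_def power2_eq_square algebra_simps)
  then show ?thesis
    using clip_projection[OF assms, of t] zero_le_power2[of "s - clip N t"] by linarith
qed

lemma huber_nonneg: "N \<ge> 0 \<Longrightarrow> 0 \<le> huber N t"
  using huber_ge[of 0 N t] by simp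

text \<open>\<open>2 * clip N s\<close> is a subgradient at \<open>s\<close>: the parameter optimal
  at \<open>s\<close> is still admissible at \<open>t\<close>.\<close>

lemma huber_diff: "N \<ge> 0 \<Longrightarrow> huber N s - huber N t \<le> 2 * clip N s * (s - t)"
  using huber_ge[of "clip N s" N t] clip_bounds[of N s] by (simp add: huber_def algebra_simps)

lemma huber_mono:
  assumes "N \<ge> 0" "s \<le> t"
  shows "huber N s \<le> huber N t"
proof -
  have "2 * clip N s * (s - t) \<le> 0"
    using assms clip_bounds[of N s] by (intro mult_nonneg_nonpos) auto
  then show ?thesis using huber_diff[OF assms(1), of s t] by linarith
qed

lemma huber_lipschitz:
  assumes "N \<ge> 0"
  shows "\<bar>huber N s - huber N t\<bar> \<le> 2 * N * \<bar>s - t\<bar>"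
proof -
  have "huber N s - huber N t \<le> 2 * N * \<bar>s - t\<bar>" for s t
  proof -
    have "2 * clip N s * (s - t) \<le> 2 * clip N s * \<bar>s - t\<bar>"
      using clip_bounds[OF assms, of s] by (intro mult_left_mono) auto
    also have "\<dots> \<le> 2 * N * \<bar>s - t\<bar>"
      using clip_bounds[OF assms, of s] by (intro mult_right_mono) auto
    finally show ?thesis using huber_diff[OF assms, of s t] by linarith
  qed
  from this[of s t] this[of t s] show ?thesis by (simp add: abs_minus_commute abs_le_iff)
qed

lemma huber_le_square: "huber N t \<le> t\<^sup>2"
  using zero_le_power2[of "t - clip N t"] by (simp add: huber_def power2_eq_square algebra_simps)

lemma huber_ge_square: "0 \<le> N \<Longrightarrow> N \<le> t \<Longrightarrow> N\<^sup>2 \<le> huber N t"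
  using huber_ge[of N N t] mult_left_mono[of N t N] by (simp add: power2_eq_square)

text \<open>The slope \<open>2 * clip N x\<close> is nonnegative, so a sublinear expectation can be
  taken of the linear term without losing its sign. The remainder is truncated at the same level
  because two clipped values differ by at most \<open>N\<close>.\<close>

lemma huber_taylor:
  assumes "N \<ge> 0"
  shows "huber N (x + y) \<le> huber N x + 2 * clip N x * y + huber N \<bar>y\<bar>"
proof -
  define s where "s = clip N (x + y) - clip N x"
  have "huber N (x + y) - huber N x - 2 * clip N x * y
      = 2 * s * y - s\<^sup>2 + 2 * ((x - clip N x) * (clip N (x + y) - clip N x))"
    by (simp add: huber_def s_def power2_eq_square algebra_simps)
  also have "\<dots> \<le> 2 * s * y - s\<^sup>2"
    using clip_projection[of "clip N (x + y)" N x] clip_bounds[OF assms, of "x + y"] by simp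
  also have "\<dots> \<le> 2 * \<bar>s\<bar> * \<bar>y\<bar> - \<bar>s\<bar>\<^sup>2"
    using abs_ge_self[of "s * y"] by (simp add: abs_mult)
  also have "\<dots> \<le> huber N \<bar>y\<bar>"
    using clip_bounds[OF assms, of x] clip_bounds[OF assms, of "x + y"]
    by (intro huber_ge) (auto simp: s_def)
  finally show ?thesis by linarith
qed

text \<open>Jensen's inequality for the mean of the values \<open>card J * a j\<close>: the
  parameter optimal for the whole sum is admissible in each term.\<close>

lemma huber_sum:
  fixes a :: "'b \<Rightarrow> real"
  assumes "N \<ge> 0" "finite J" "J \<noteq> {}"
  shows "huber N (\<Sum>j\<in>J. a j) \<le> (\<Sum>j\<in>J. huber N (card J * a j)) / card J"
proof -
  define c where "c = clip N (\<Sum>j\<in>J. a j)"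
  have J: "real (card J) > 0" using assms by (simp add: card_gt_0_iff)
  have "card J * huber N (\<Sum>j\<in>J. a j) = (\<Sum>j\<in>J. 2 * c * (card J * a j) - c\<^sup>2)"
    by (simp add: huber_def c_def[symmetric] sum_subtractf sum_distrib_left sum_distrib_right algebra_simps)
  also have "\<dots> \<le> (\<Sum>j\<in>J. huber N (card J * a j))"
    using clip_bounds[OF assms(1)] by (intro sum_mono huber_ge) (auto simp: c_def)
  finally show ?thesis using J by (simp add: field_simps)
qed

section \<open>Tail bounds for mixing sequences\<close>

lemma l1norm_nonneg: "0 \<le> l1norm x"
  by (simp add: l1norm_def sum_nonneg)

lemma norm_le_l1norm: "norm x \<le> l1norm x"
  unfolding l1norm_def by (rule norm_le_l1_cart)

lemma abs_inner_le_l1norm: "\<bar>p \<bullet> x\<bar> \<le> norm p * l1norm x"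
  using Cauchy_Schwarz_ineq2[of p x] mult_left_mono[OF norm_le_l1norm[of x], of "norm p"] by simp

section \<open>Blocks of indices and their residue classes\<close>

definition block :: "nat \<Rightarrow> nat \<Rightarrow> nat set" where
  "block m b = {Suc (b * m)..<Suc (b * m + m)}"

text \<open>The number \<open>k\<close> of blocks is a parameter so that a class can be built up one
  block at a time.\<close>

definition block_class :: "nat \<Rightarrow> nat \<Rightarrow> nat \<Rightarrow> nat \<Rightarrow> nat set" where
  "block_class m r i k = (\<Union>s<k. block m (i + r * s))"

lemma finite_block_class: "finite (block_class m r i k)"
  by (simp add: block_class_def block_def)

lemma block_class_Suc: "block_class m r i (Suc k) = block_class m r i k \<union> block m (i + r * k)"
  by (auto simp: block_class_def lessThan_Suc)

lemma card_block_class: "card (block_class m r i k) \<le> m * k"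
proof -
  have "card (block_class m r i k) \<le> (\<Sum>s<k. card (block m (i + r * s)))"
    unfolding block_class_def by (intro card_UN_le) simp
  then show ?thesis by (simp add: block_def mult.commute)
qed

text \<open>Block numbers within a class differ by at least \<open>r\<close>, so the last index of
  one block and the first of a later one are at least (r - 1) m + 1 apart.\<close>

lemma block_class_gap:
  assumes "m \<ge> 1" "r \<ge> 1" "j \<in> block_class m r i k" "j' \<in> block m (i + r * k)"
  shows "j + r \<le> j'"
proof -
  obtain s where s: "s < k" "j \<le> (i + r * s) * m + m"
    using assms(3) by (auto simp: block_class_def block_def)
  have "(i + r * s) * m + r * m = (i + r * Suc s) * m" by (simp add: algebra_simps)
  also have "\<dots> \<le> (i + r * k) * m"
    using s(1) by (intro mult_le_mono1 add_left_mono mult_le_mono2) simp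
  finally have "(i + r * s) * m + r * m \<le> (i + r * k) * m" .
  \<comment> \<open>This is (m - 1) (r - 1) \<ge> 0.\<close>
  moreover have "m + r \<le> r * m + 1"
  proof -
    obtain a b where "m = Suc a" "r = Suc b" using assms(1,2) by (metis Suc_le_D One_nat_def)
    then show ?thesis by simp
  qed
  ultimately show ?thesis using s(2) assms(4) by (auto simp: block_def)
qed

lemma sum_block_class:
  assumes "m \<ge> 1" "r \<ge> 1"
  shows "sum f (block_class m r i k) = (\<Sum>s<k. sum f (block m (i + r * s)))"
proof (induction k)
  case (Suc k)
  have "block_class m r i k \<inter> block m (i + r * k) = {}"
    using block_class_gap[OF assms, of _ i k] assms by fastforce
  then show ?case
    using Suc by (simp add: block_class_Suc sum.union_disjoint finite_block_class block_def)
qed (simp add: block_class_def)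

lemma sum_block_classes:
  assumes "m \<ge> 1" "r \<ge> 1"
  shows "(\<Sum>i<r. sum f (block_class m r i q)) = sum f {1..q * r * m}"
proof -
  \<comment> \<open>The blocks form an array: row \<open>s\<close> consists of \<open>r\<close>
    consecutive blocks, column \<open>i\<close> is the class of \<open>i\<close>.\<close>
  have row: "(\<Sum>i<r. sum f (block m (i + r * s))) = (\<Sum>b\<in>{s * r..<s * r + r}. sum f (block m b))" for s
    by (rule sum.reindex_bij_witness[of _ "\<lambda>b. b - s * r" "\<lambda>i. i + s * r"])
      (auto simp: mult.commute)
  have "(\<Sum>i<r. sum f (block_class m r i q)) = (\<Sum>s<q. \<Sum>i<r. sum f (block m (i + r * s)))"
    by (subst sum.swap) (simp add: sum_block_class[OF assms])
  also have "\<dots> = (\<Sum>s<q. \<Sum>b\<in>{s * r..<s * r + r}. sum f (block m b))"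
    by (simp only: row)
  also have "\<dots> = (\<Sum>b<q * r. sum f (block m b))"
    by (rule sum.nat_group)
  also have "\<dots> = (\<Sum>b<q * r. sum (f \<circ> Suc) {b * m..<b * m + m})"
    unfolding block_def sum.shift_bounds_Suc_ivl by (simp add: comp_def)
  also have "\<dots> = sum (f \<circ> Suc) {..<q * r * m}"
    by (rule sum.nat_group)
  also have "\<dots> = sum f {1..q * r * m}"
    by (intro sum.reindex_bij_witness[of _ "\<lambda>j. j - 1" Suc]) auto
  finally show ?thesis .
qed

section \<open>Truncated second moments under stationarity and mixing\<close>

locale mixing_sequence = sublinear_space H Ehat
  for H :: "('a \<Rightarrow> real) set" and Ehat +
  fixes X :: "nat \<Rightarrow> 'a \<Rightarrow> real ^ 'd" and \<alpha> c :: real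
  assumes component_mem: "k \<ge> 1 \<Longrightarrow> (\<lambda>\<omega>. X k \<omega> $ i) \<in> H"
    and stat: "stationary Ehat X"
    and \<alpha>_pos: "\<alpha> > 0" and c_pos: "c > 0"
    and mixing: "\<And>\<Lambda>1 \<Lambda>2 \<phi> L. \<lbrakk>finite \<Lambda>1; \<Lambda>1 \<noteq> {}; \<Lambda>1 \<subseteq> {1..}; finite \<Lambda>2; \<Lambda>2 \<noteq> {}; \<Lambda>2 \<subseteq> {1..};
        Max \<Lambda>1 \<le> Min \<Lambda>2; L > 0; lipschitz_wrt dist_pair L \<phi>\<rbrakk> \<Longrightarrow>
        \<bar>Ehat (\<lambda>\<omega>. \<phi> (average X \<Lambda>1 \<omega>, average X \<Lambda>2 \<omega>)) -
         Ehat (\<lambda>\<omega>. Ehat (\<lambda>\<omega>'. \<phi> (average X \<Lambda>1 \<omega>, average X \<Lambda>2 \<omega>')))\<bar>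
        \<le> c * L * exp (- \<alpha> * \<bar>real (Min \<Lambda>2) - real (Max \<Lambda>1)\<bar>)"
    and square_mem: "(\<lambda>\<omega>. (l1norm (X 1 \<omega>))\<^sup>2) \<in> H"
begin

lemma inner_mem: "k \<ge> 1 \<Longrightarrow> (\<lambda>\<omega>. p \<bullet> X k \<omega>) \<in> H"
  unfolding inner_vec_def by (auto intro!: sum_mem scale_mem component_mem)

lemma Ehat_stationary:
  assumes "k \<ge> 1" "\<And>v w. \<bar>f v - f w\<bar> \<le> L * l1norm (v - w)"
  shows "Ehat (\<lambda>\<omega>. f (X k \<omega>)) = Ehat (\<lambda>\<omega>. f (X 1 \<omega>))"
\<comment> \<open>Stationarity speaks of shifts by at least 1, so the trivial shift is treated
  apart.\<close>
proof (cases "k = 1")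
  case False
  have "lipschitz_wrt (dist_fin_vec 1) L (\<lambda>v. f (v 0))"
    using assms(2) by (simp add: lipschitz_wrt_def dist_fin_vec_def)
  moreover have "k - 1 \<ge> 1" using assms False by simp
  ultimately have "Ehat (\<lambda>\<omega>. (\<lambda>v. f (v 0)) (\<lambda>i. X ((\<lambda>i. 1) i) \<omega>))
      = Ehat (\<lambda>\<omega>. (\<lambda>v. f (v 0)) (\<lambda>i. X (k - 1 + (\<lambda>i. 1) i) \<omega>))"
    using stat[unfolded stationary_def, rule_format, of 1 "k - 1" "\<lambda>i. 1" L "\<lambda>v. f (v 0)"] by simp
  then show ?thesis using assms(1) by simp
qed simp

text \<open>The centring \<open>\<mu>\<close> will be \<open>support m p\<close>, which makes the
  expected sum over a block of length \<open>m\<close> nonpositive.\<close>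

definition proj :: "real ^ 'd \<Rightarrow> real \<Rightarrow> nat \<Rightarrow> 'a \<Rightarrow> real" where
  "proj p \<mu> k \<omega> = p \<bullet> X k \<omega> - \<mu>"

text \<open>An upper bound for second moments of \<open>proj p \<mu> j\<close>, from (a - b)^2 \<le>
  2 a^2 + 2 b^2. It is phrased through the square of |X_1|, the one square assumed to lie in
  \<open>H\<close>.\<close>

definition moment :: "real ^ 'd \<Rightarrow> real \<Rightarrow> real" where
  "moment p \<mu> = 2 * (norm p)\<^sup>2 * Ehat (\<lambda>\<omega>. (l1norm (X 1 \<omega>))\<^sup>2) + 2 * \<mu>\<^sup>2"

lemma moment_nonneg: "0 \<le> moment p \<mu>"
proof -
  have "Ehat (\<lambda>\<omega>. 0) \<le> Ehat (\<lambda>\<omega>. (l1norm (X 1 \<omega>))\<^sup>2)"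
    by (intro Ehat_mono const_mem square_mem) simp
  then show ?thesis by (simp add: moment_def Ehat_const)
qed

lemma proj_mem: "k \<ge> 1 \<Longrightarrow> proj p \<mu> k \<in> H"
  unfolding proj_def by (intro diff_mem inner_mem const_mem)

lemma sum_proj_mem: "J \<subseteq> {1..} \<Longrightarrow> (\<lambda>\<omega>. \<Sum>j\<in>J. proj p \<mu> j \<omega>) \<in> H"
  by (intro sum_mem proj_mem) auto

lemma sum_abs_proj_mem: "J \<subseteq> {1..} \<Longrightarrow> (\<lambda>\<omega>. \<Sum>j\<in>J. \<bar>proj p \<mu> j \<omega>\<bar>) \<in> H"
  by (intro sum_mem abs_mem proj_mem) auto

lemma huber_mem: "Z \<in> H \<Longrightarrow> N \<ge> 0 \<Longrightarrow> (\<lambda>\<omega>. huber N (Z \<omega>)) \<in> H"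
  by (rule lipschitz_mem[where f = "huber N"]) (auto intro: huber_lipschitz)

lemma Ehat_sum_shift:
  assumes "m \<ge> 1"
  shows "Ehat (\<lambda>\<omega>. \<Sum>j\<in>block m b. proj p \<mu> j \<omega>) = Ehat (\<lambda>\<omega>. \<Sum>j=1..m. proj p \<mu> j \<omega>)"
proof -
  let ?\<psi> = "\<lambda>v. \<Sum>i<m. p \<bullet> v i - \<mu>"
  have reindex: "(\<Sum>j\<in>block m b. proj p \<mu> j \<omega>) = ?\<psi> (\<lambda>i. X (b * m + Suc i) \<omega>)" for b \<omega>
    unfolding block_def proj_def
    by (intro sum.reindex_bij_witness[of _ "\<lambda>i. b * m + Suc i" "\<lambda>j. j - Suc (b * m)"]) auto
  have "block m 0 = {1..m}" by (auto simp: block_def)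
  then have reindex0: "(\<Sum>j=1..m. proj p \<mu> j \<omega>) = ?\<psi> (\<lambda>i. X (Suc i) \<omega>)" for \<omega>
    using reindex[where b = 0] by simp
  show ?thesis
  proof (cases "b = 0")
    case False
    have "\<bar>?\<psi> v - ?\<psi> w\<bar> \<le> norm p * dist_fin_vec m v w" for v w
    proof -
      have "\<bar>?\<psi> v - ?\<psi> w\<bar> = \<bar>\<Sum>i<m. p \<bullet> (v i - w i)\<bar>"
        by (simp add: sum_subtractf[symmetric] inner_diff_right)
      also have "\<dots> \<le> (\<Sum>i<m. norm p * l1norm (v i - w i))"
        by (intro order_trans[OF sum_abs] sum_mono abs_inner_le_l1norm)
      finally show ?thesis by (simp add: dist_fin_vec_def sum_distrib_left)
    qed
    then have "lipschitz_wrt (dist_fin_vec m) (norm p) ?\<psi>" by (simp add: lipschitz_wrt_def)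
    moreover have "b * m \<ge> 1" using False assms by simp
    ultimately show ?thesis
      unfolding reindex reindex0
      using stat[unfolded stationary_def, rule_format, of m "b * m" Suc "norm p" ?\<psi>] assms
      by simp
  qed (simp add: \<open>block m 0 = {1..m}\<close>)
qed

text \<open>Stationarity transfers expectations of Lipschitz functions only. The truncated square is
  one, so it can be moved to index 1, and there it is dominated by the full square.\<close>

lemma Ehat_huber_proj:
  assumes "N \<ge> 0" "w \<ge> 0" "j \<ge> 1"
  shows "Ehat (\<lambda>\<omega>. huber N (w * \<bar>proj p \<mu> j \<omega>\<bar>)) \<le> w\<^sup>2 * moment p \<mu>"
proof -
  let ?f = "\<lambda>v. huber N (w * \<bar>p \<bullet> v - \<mu>\<bar>)"
  have "\<bar>?f v - ?f v'\<bar> \<le> (2 * N * w * norm p) * l1norm (v - v')" for v v'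
  proof -
    have "\<bar>?f v - ?f v'\<bar> \<le> 2 * N * \<bar>w * \<bar>p \<bullet> v - \<mu>\<bar> - w * \<bar>p \<bullet> v' - \<mu>\<bar>\<bar>"
      using assms by (intro huber_lipschitz)
    also have "\<bar>w * \<bar>p \<bullet> v - \<mu>\<bar> - w * \<bar>p \<bullet> v' - \<mu>\<bar>\<bar> = w * \<bar>\<bar>p \<bullet> v - \<mu>\<bar> - \<bar>p \<bullet> v' - \<mu>\<bar>\<bar>"
      using assms by (simp add: right_diff_distrib[symmetric] abs_mult)
    also have "\<dots> \<le> w * \<bar>p \<bullet> (v - v')\<bar>"
      using assms by (intro mult_left_mono) (auto simp: inner_diff_right)
    also have "\<dots> \<le> w * (norm p * l1norm (v - v'))"
      using assms by (intro mult_left_mono abs_inner_le_l1norm)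
    finally show ?thesis using assms by (simp add: mult_left_mono mult.assoc)
  qed
  then have "Ehat (\<lambda>\<omega>. huber N (w * \<bar>proj p \<mu> j \<omega>\<bar>)) = Ehat (\<lambda>\<omega>. ?f (X 1 \<omega>))"
    unfolding proj_def by (intro Ehat_stationary assms)
  also have "\<dots> \<le> Ehat (\<lambda>\<omega>. w\<^sup>2 * (2 * (norm p)\<^sup>2) * (l1norm (X 1 \<omega>))\<^sup>2) + w\<^sup>2 * (2 * \<mu>\<^sup>2)"
  proof (rule Ehat_le_add_const)
    show "(\<lambda>\<omega>. ?f (X 1 \<omega>)) \<in> H"
      using assms proj_mem[of 1 p \<mu>] unfolding proj_def
      by (intro huber_mem scale_mem abs_mem) auto
    show "(\<lambda>\<omega>. w\<^sup>2 * (2 * (norm p)\<^sup>2) * (l1norm (X 1 \<omega>))\<^sup>2) \<in> H"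
      by (intro scale_mem square_mem)
    fix \<omega>
    let ?x = "X 1 \<omega>"
    have "?f ?x \<le> (w * \<bar>p \<bullet> ?x - \<mu>\<bar>)\<^sup>2" by (rule huber_le_square)
    also have "\<dots> = w\<^sup>2 * (p \<bullet> ?x - \<mu>)\<^sup>2" by (simp add: power_mult_distrib)
    also have "\<dots> \<le> w\<^sup>2 * (2 * (norm p * l1norm ?x)\<^sup>2 + 2 * \<mu>\<^sup>2)"
    proof (rule mult_left_mono)
      have "(p \<bullet> ?x - \<mu>)\<^sup>2 \<le> 2 * (p \<bullet> ?x)\<^sup>2 + 2 * \<mu>\<^sup>2"
        using zero_le_power2[of "p \<bullet> ?x + \<mu>"] by (simp add: power2_eq_square algebra_simps)
      also have "(p \<bullet> ?x)\<^sup>2 \<le> (norm p * l1norm ?x)\<^sup>2"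
        using power_mono[OF abs_inner_le_l1norm[of p ?x], of 2] by simp
      finally show "(p \<bullet> ?x - \<mu>)\<^sup>2 \<le> 2 * (norm p * l1norm ?x)\<^sup>2 + 2 * \<mu>\<^sup>2" by simp
    qed simp
    finally show "?f ?x \<le> w\<^sup>2 * (2 * (norm p)\<^sup>2) * (l1norm ?x)\<^sup>2 + w\<^sup>2 * (2 * \<mu>\<^sup>2)"
      by (simp add: power_mult_distrib algebra_simps)
  qed
  also have "\<dots> = w\<^sup>2 * moment p \<mu>"
    by (subst Ehat_scale[OF square_mem]) (simp_all add: moment_def algebra_simps)
  finally show ?thesis .
qed

text \<open>Convexity alone, whatever the dependence, costs a factor quadratic in the number of
  indices. This is affordable for a single block of fixed length and for the gaps between the times
  m r^3.\<close>

lemma Ehat_huber_sum: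
  assumes "N \<ge> 0" "finite J" "J \<subseteq> {1..}"
  shows "Ehat (\<lambda>\<omega>. huber N (\<Sum>j\<in>J. \<bar>proj p \<mu> j \<omega>\<bar>)) \<le> (real (card J))\<^sup>2 * moment p \<mu>"
proof (cases "J = {}")
  case True
  then show ?thesis using huber_le_square[of N 0] by (simp add: Ehat_const)
next
  case False
  define w where "w = real (card J)"
  have w: "w > 0" using False assms by (simp add: w_def card_gt_0_iff)
  have mem: "(\<lambda>\<omega>. huber N (w * \<bar>proj p \<mu> j \<omega>\<bar>)) \<in> H" if "j \<in> J" for j
    using that assms by (intro huber_mem scale_mem abs_mem proj_mem) auto
  have "Ehat (\<lambda>\<omega>. huber N (\<Sum>j\<in>J. \<bar>proj p \<mu> j \<omega>\<bar>))
      \<le> Ehat (\<lambda>\<omega>. (1 / w) * (\<Sum>j\<in>J. huber N (w * \<bar>proj p \<mu> j \<omega>\<bar>)))"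
    using assms False huber_sum[OF assms(1,2) False] unfolding w_def[symmetric]
    by (intro Ehat_mono huber_mem sum_abs_proj_mem scale_mem sum_mem mem) auto
  also have "\<dots> = (1 / w) * Ehat (\<lambda>\<omega>. \<Sum>j\<in>J. huber N (w * \<bar>proj p \<mu> j \<omega>\<bar>))"
    using w by (intro Ehat_scale sum_mem mem) auto
  also have "\<dots> \<le> (1 / w) * (\<Sum>j\<in>J. Ehat (\<lambda>\<omega>. huber N (w * \<bar>proj p \<mu> j \<omega>\<bar>)))"
    using w by (intro mult_left_mono Ehat_sum mem) auto
  also have "\<dots> \<le> (1 / w) * (\<Sum>j\<in>J. w\<^sup>2 * moment p \<mu>)"
    using w assms by (intro mult_left_mono sum_mono Ehat_huber_proj) auto
  also have "\<dots> = w\<^sup>2 * moment p \<mu>" using w by (simp add: w_def[symmetric])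
  finally show ?thesis by (simp add: w_def)
qed

lemma huber_step:
  assumes "N > 0" "finite \<Lambda>1" "\<Lambda>1 \<noteq> {}" "\<Lambda>1 \<subseteq> {1..}" "finite \<Lambda>2" "\<Lambda>2 \<noteq> {}" "\<Lambda>2 \<subseteq> {1..}"
    and gap: "\<And>j j'. j \<in> \<Lambda>1 \<Longrightarrow> j' \<in> \<Lambda>2 \<Longrightarrow> j + r \<le> j'"
    and neg: "Ehat (\<lambda>\<omega>. \<Sum>j\<in>\<Lambda>2. proj p \<mu> j \<omega>) \<le> 0"
  shows "Ehat (\<lambda>\<omega>. huber N ((\<Sum>j\<in>\<Lambda>1. proj p \<mu> j \<omega>) + (\<Sum>j\<in>\<Lambda>2. proj p \<mu> j \<omega>)))
    \<le> Ehat (\<lambda>\<omega>. huber N (\<Sum>j\<in>\<Lambda>1. proj p \<mu> j \<omega>))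
      + (Ehat (\<lambda>\<omega>. huber N \<bar>\<Sum>j\<in>\<Lambda>2. proj p \<mu> j \<omega>\<bar>)
      + c * (2 * N * (real (card \<Lambda>1) + real (card \<Lambda>2)) * (norm p + 1)) * exp (- \<alpha> * real r))"
proof -
  define S1 where "S1 \<omega> = (\<Sum>j\<in>\<Lambda>1. proj p \<mu> j \<omega>)" for \<omega>
  define S2 where "S2 \<omega> = (\<Sum>j\<in>\<Lambda>2. proj p \<mu> j \<omega>)" for \<omega>
  have S1: "S1 \<in> H" and S2: "S2 \<in> H"
    using sum_proj_mem assms unfolding S1_def S2_def by auto
  define a where "a = real (card \<Lambda>1)"
  define b where "b = real (card \<Lambda>2)"
  have ab: "a > 0" "b > 0" using assms by (auto simp: a_def b_def card_gt_0_iff)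
  \<comment> \<open>Mixing concerns averages, and the cardinalities rescale them to sums. The
    summand 1 keeps \<open>L\<close> positive when p = 0.\<close>
  define L where "L = 2 * N * (a + b) * (norm p + 1)"
  have "L > 0" using ab assms(1) by (simp add: L_def add_nonneg_pos)
  define \<phi> where "\<phi> = (\<lambda>(x, y). huber N (a * (p \<bullet> x - \<mu>) + b * (p \<bullet> y - \<mu>)))"
  have avg: "real (card \<Lambda>) * (p \<bullet> average X \<Lambda> \<omega> - \<mu>) = (\<Sum>j\<in>\<Lambda>. proj p \<mu> j \<omega>)"
    if "finite \<Lambda>" "\<Lambda> \<noteq> {}" for \<Lambda> \<omega>
    using that by (simp add: average_def proj_def inner_sum_right sum_subtractf algebra_simps)
  have avg1: "a * (p \<bullet> average X \<Lambda>1 \<omega> - \<mu>) = S1 \<omega>"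
    and avg2: "b * (p \<bullet> average X \<Lambda>2 \<omega> - \<mu>) = S2 \<omega>" for \<omega>
    using avg assms unfolding a_def b_def S1_def S2_def by auto
  have lip: "lipschitz_wrt dist_pair L \<phi>"
    unfolding lipschitz_wrt_def
  proof (intro allI)
    fix u v :: "(real ^ 'd) \<times> (real ^ 'd)"
    obtain x y where u: "u = (x, y)" by (cases u)
    obtain x' y' where v: "v = (x', y')" by (cases v)
    have "\<bar>\<phi> u - \<phi> v\<bar> \<le> 2 * N * \<bar>(a * (p \<bullet> x - \<mu>) + b * (p \<bullet> y - \<mu>)) - (a * (p \<bullet> x' - \<mu>) + b * (p \<bullet> y' - \<mu>))\<bar>"
      unfolding \<phi>_def u v prod.case using assms(1) by (intro huber_lipschitz) simp
    also have "(a * (p \<bullet> x - \<mu>) + b * (p \<bullet> y - \<mu>)) - (a * (p \<bullet> x' - \<mu>) + b * (p \<bullet> y' - \<mu>))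
        = a * (p \<bullet> (x - x')) + b * (p \<bullet> (y - y'))"
      by (simp add: inner_diff_right algebra_simps)
    also have "\<bar>\<dots>\<bar> \<le> a * \<bar>p \<bullet> (x - x')\<bar> + b * \<bar>p \<bullet> (y - y')\<bar>"
      using ab by (intro order_trans[OF abs_triangle_ineq]) (simp add: abs_mult)
    also have "\<dots> \<le> (a + b) * ((norm p + 1) * l1norm (x - x')) + (a + b) * ((norm p + 1) * l1norm (y - y'))"
    proof -
      have "\<bar>p \<bullet> z\<bar> \<le> (norm p + 1) * l1norm z" for z
        using abs_inner_le_l1norm[of p z] l1norm_nonneg[of z] by (simp add: algebra_simps)
      then show ?thesis
        using ab by (intro add_mono mult_mono) auto
    qed
    finally show "\<bar>\<phi> u - \<phi> v\<bar> \<le> L * dist_pair u v"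
      using assms(1) by (simp add: L_def dist_pair_def u v algebra_simps)
  qed
  have mem: "(\<lambda>\<omega>. huber N (t + S2 \<omega>)) \<in> H" for t
    using assms(1) by (intro huber_mem add_mem const_mem S2) simp
  have memabs: "(\<lambda>\<omega>. huber N \<bar>S2 \<omega>\<bar>) \<in> H"
    using assms(1) by (intro huber_mem abs_mem S2) simp
  \<comment> \<open>The inner expectation, with the first sum frozen at \<open>t\<close>.\<close>
  define g where "g t = Ehat (\<lambda>\<omega>. huber N (t + S2 \<omega>))" for t
  have g_le: "g t \<le> huber N t + Ehat (\<lambda>\<omega>. huber N \<bar>S2 \<omega>\<bar>)" for t
  proof -
    have "g t \<le> Ehat (\<lambda>\<omega>. 2 * clip N t * S2 \<omega> + huber N \<bar>S2 \<omega>\<bar>) + huber N t"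
      unfolding g_def
    proof (intro Ehat_le_add_const mem add_mem scale_mem S2 memabs)
      show "huber N (t + S2 \<omega>) \<le> 2 * clip N t * S2 \<omega> + huber N \<bar>S2 \<omega>\<bar> + huber N t" for \<omega>
        using huber_taylor[of N t "S2 \<omega>"] assms(1) by simp
    qed
    also have "Ehat (\<lambda>\<omega>. 2 * clip N t * S2 \<omega> + huber N \<bar>S2 \<omega>\<bar>)
        \<le> Ehat (\<lambda>\<omega>. 2 * clip N t * S2 \<omega>) + Ehat (\<lambda>\<omega>. huber N \<bar>S2 \<omega>\<bar>)"
      by (intro Ehat_add scale_mem S2 memabs)
    also have "Ehat (\<lambda>\<omega>. 2 * clip N t * S2 \<omega>) = 2 * clip N t * Ehat S2"
      using clip_bounds[of N t] assms(1) by (intro Ehat_scale S2) simp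
    also have "\<dots> \<le> 0"
      using clip_bounds[of N t] assms(1) neg unfolding S2_def
      by (intro mult_nonneg_nonpos) auto
    finally show ?thesis by simp
  qed
  \<comment> \<open>This makes \<open>g (S1 \<omega>)\<close> a random variable in \<open>H\<close>,
    so that \<open>Ehat\<close> is monotone at it.\<close>
  have g_lip: "\<bar>g s - g t\<bar> \<le> 2 * N * \<bar>s - t\<bar>" for s t
  proof -
    have "g s \<le> g t + 2 * N * \<bar>s - t\<bar>" for s t
      unfolding g_def
    proof (intro Ehat_le_add_const mem)
      fix \<omega> show "huber N (s + S2 \<omega>) \<le> huber N (t + S2 \<omega>) + 2 * N * \<bar>s - t\<bar>"
        using huber_lipschitz[of N "s + S2 \<omega>" "t + S2 \<omega>"] assms(1) by auto
    qed
    from this[of s t] this[of t s] show ?thesis by (simp add: abs_minus_commute abs_le_iff)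
  qed
  have sep: "Max \<Lambda>1 + r \<le> Min \<Lambda>2" using assms by (intro gap) auto
  have "Ehat (\<lambda>\<omega>. huber N (S1 \<omega> + S2 \<omega>)) - Ehat (\<lambda>\<omega>. g (S1 \<omega>))
      \<le> c * L * exp (- \<alpha> * \<bar>real (Min \<Lambda>2) - real (Max \<Lambda>1)\<bar>)"
    using mixing[OF assms(2-7) _ \<open>L > 0\<close> lip] sep
    unfolding \<phi>_def prod.case avg1 avg2 g_def by simp
  also have "\<dots> \<le> c * L * exp (- \<alpha> * real r)"
    using sep c_pos \<open>L > 0\<close> \<alpha>_pos by (intro mult_left_mono) auto
  finally have "Ehat (\<lambda>\<omega>. huber N (S1 \<omega> + S2 \<omega>))
      \<le> Ehat (\<lambda>\<omega>. g (S1 \<omega>)) + c * L * exp (- \<alpha> * real r)" by simp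
  moreover have "Ehat (\<lambda>\<omega>. g (S1 \<omega>)) \<le> Ehat (\<lambda>\<omega>. huber N (S1 \<omega>)) + Ehat (\<lambda>\<omega>. huber N \<bar>S2 \<omega>\<bar>)"
    using assms(1) g_le
    by (intro Ehat_le_add_const huber_mem S1 lipschitz_mem[where f = g, OF S1 g_lip]) auto
  ultimately show ?thesis
    unfolding S1_def S2_def L_def a_def b_def by simp
qed

lemma Ehat_huber_block:
  assumes "N \<ge> 0"
  shows "Ehat (\<lambda>\<omega>. huber N \<bar>\<Sum>j\<in>block m b. proj p \<mu> j \<omega>\<bar>) \<le> (real m)\<^sup>2 * moment p \<mu>"
proof -
  have block: "block m b \<subseteq> {1..}" "finite (block m b)" "card (block m b) = m"
    by (auto simp: block_def)
  have "Ehat (\<lambda>\<omega>. huber N \<bar>\<Sum>j\<in>block m b. proj p \<mu> j \<omega>\<bar>)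
      \<le> Ehat (\<lambda>\<omega>. huber N (\<Sum>j\<in>block m b. \<bar>proj p \<mu> j \<omega>\<bar>))"
    using assms block
    by (intro Ehat_mono huber_mem abs_mem sum_proj_mem sum_abs_proj_mem huber_mono sum_abs) auto
  also have "\<dots> \<le> (real m)\<^sup>2 * moment p \<mu>"
    using Ehat_huber_sum[OF assms block(2,1), of p \<mu>] block(3) by simp
  finally show ?thesis .
qed

text \<open>Consecutive blocks of one class are separated by a gap of length at least \<open>r\<close>, so adding them one
  by one costs a second moment each, plus a mixing error that is exponentially small in \<open>r\<close>.\<close>

lemma Ehat_huber_block_class:
  assumes "N > 0" "m \<ge> 1" "r \<ge> 1" "k \<le> q"
    and neg: "Ehat (\<lambda>\<omega>. \<Sum>j=1..m. proj p \<mu> j \<omega>) \<le> 0"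
  shows "Ehat (\<lambda>\<omega>. huber N (\<Sum>j\<in>block_class m r i k. proj p \<mu> j \<omega>))
    \<le> real k * ((real m)\<^sup>2 * moment p \<mu>
        + c * (2 * N * (real m * real q) * (norm p + 1)) * exp (- \<alpha> * real r))"
  using assms(4)
proof (induction k)
  case 0
  then show ?case using huber_le_square[of N 0] by (simp add: block_class_def Ehat_const)
next
  case (Suc k)
  define B where "B = block m (i + r * k)"
  define \<Lambda> where "\<Lambda> = block_class m r i k"
  define D where "D = (real m)\<^sup>2 * moment p \<mu>"
  define err where "err = c * (2 * N * (real m * real q) * (norm p + 1)) * exp (- \<alpha> * real r)"
  have "err \<ge> 0" using c_pos assms(1) by (auto simp: err_def intro!: mult_nonneg_nonneg)
  have B: "B \<subseteq> {1..}" "finite B" "B \<noteq> {}" "card B = m"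
    using assms(2) by (auto simp: block_def B_def)
  have \<Lambda>: "\<Lambda> \<subseteq> {1..}" "finite \<Lambda>"
    using finite_block_class by (auto simp: block_def block_class_def \<Lambda>_def)
  have EB: "Ehat (\<lambda>\<omega>. huber N \<bar>\<Sum>j\<in>B. proj p \<mu> j \<omega>\<bar>) \<le> D"
    using Ehat_huber_block[of N] assms(1) by (simp add: B_def D_def)
  have split: "(\<Sum>j\<in>block_class m r i (Suc k). proj p \<mu> j \<omega>)
      = (\<Sum>j\<in>\<Lambda>. proj p \<mu> j \<omega>) + (\<Sum>j\<in>B. proj p \<mu> j \<omega>)" for \<omega>
    using assms by (simp add: sum_block_class \<Lambda>_def B_def)
  have "Ehat (\<lambda>\<omega>. huber N ((\<Sum>j\<in>\<Lambda>. proj p \<mu> j \<omega>) + (\<Sum>j\<in>B. proj p \<mu> j \<omega>)))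
      \<le> Ehat (\<lambda>\<omega>. huber N (\<Sum>j\<in>\<Lambda>. proj p \<mu> j \<omega>)) + (D + err)"
  \<comment> \<open>The first block has no predecessors, and the mixing condition concerns nonempty
    sets only.\<close>
  proof (cases "\<Lambda> = {}")
    case True
    have "Ehat (\<lambda>\<omega>. huber N (\<Sum>j\<in>B. proj p \<mu> j \<omega>)) \<le> Ehat (\<lambda>\<omega>. huber N \<bar>\<Sum>j\<in>B. proj p \<mu> j \<omega>\<bar>)"
      using assms(1) B by (intro Ehat_mono huber_mem abs_mem sum_proj_mem huber_mono) auto
    also have "\<dots> \<le> 0 + (D + err)" using EB \<open>err \<ge> 0\<close> by simp
    also have "0 \<le> Ehat (\<lambda>\<omega>. huber N 0)"
      using huber_nonneg[of N 0] assms(1) by (simp add: Ehat_const)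
    finally show ?thesis using True by simp
  next
    case False
    have "Ehat (\<lambda>\<omega>. huber N ((\<Sum>j\<in>\<Lambda>. proj p \<mu> j \<omega>) + (\<Sum>j\<in>B. proj p \<mu> j \<omega>)))
      \<le> Ehat (\<lambda>\<omega>. huber N (\<Sum>j\<in>\<Lambda>. proj p \<mu> j \<omega>))
      + (Ehat (\<lambda>\<omega>. huber N \<bar>\<Sum>j\<in>B. proj p \<mu> j \<omega>\<bar>)
      + c * (2 * N * (real (card \<Lambda>) + real (card B)) * (norm p + 1)) * exp (- \<alpha> * real r))"
      using assms(1-3) False B \<Lambda> block_class_gap neg Ehat_sum_shift[OF assms(2)]
      by (intro huber_step) (auto simp: B_def \<Lambda>_def)
    \<comment> \<open>Bounding the number of indices by \<open>m * q\<close> throughout keeps the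
      error the same in each induction step.\<close>
    also have "c * (2 * N * (real (card \<Lambda>) + real (card B)) * (norm p + 1)) * exp (- \<alpha> * real r) \<le> err"
    proof -
      have "card \<Lambda> + card B \<le> m * k + m"
        using card_block_class[of m r i k] B by (simp add: \<Lambda>_def)
      also have "\<dots> = m * Suc k" by simp
      also have "\<dots> \<le> m * q" using Suc.prems by (intro mult_le_mono2)
      finally have "real (card \<Lambda>) + real (card B) \<le> real m * real q"
        by (metis of_nat_add of_nat_le_iff of_nat_mult)
      then show ?thesis
        unfolding err_def using c_pos assms(1)
        by (intro mult_right_mono mult_left_mono) auto
    qed
    finally show ?thesis using EB by linarith
  qed
  moreover have "Ehat (\<lambda>\<omega>. huber N (\<Sum>j\<in>\<Lambda>. proj p \<mu> j \<omega>)) \<le> real k * (D + err)"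
    using Suc by (simp add: \<Lambda>_def D_def err_def)
  ultimately have "Ehat (\<lambda>\<omega>. huber N (\<Sum>j\<in>block_class m r i (Suc k). proj p \<mu> j \<omega>))
      \<le> real (Suc k) * (D + err)"
    unfolding split by (simp add: algebra_simps)
  then show ?case by (simp add: D_def err_def)
qed

section \<open>Tail probabilities and almost sure growth of the centred sums\<close>

lemma measurable_H:
  assumes "space M = UNIV" "sets M = sigma_rv H" "Z \<in> H"
  shows "Z \<in> borel_measurable M"
proof (rule measurableI)
  fix B :: "real set" assume "B \<in> sets borel"
  then show "Z -` B \<inter> space M \<in> sets M"
    using assms unfolding sigma_rv_def by (auto intro!: sigma_sets.Basic)
qed simp

lemma superlevel_sets:
  assumes "space M = UNIV" "sets M = sigma_rv H" "Z \<in> H"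
  shows "{\<omega>. t \<le> Z \<omega>} \<in> sets M"
  using measurable_sets[OF measurable_H[OF assms], of "{t..}"] by (simp add: assms(1) vimage_def)

text \<open>On the event the truncated square is already at least \<open>N\<^sup>2\<close>, so
  truncating at the threshold itself costs nothing. Domination by \<open>Ehat\<close> makes the
  bound the same for all \<open>P\<close>.\<close>

lemma markov_huber:
  assumes P: "P \<in> dominated_probabilities H Ehat" and Z: "Z \<in> H" and N: "N > 0"
  shows "measure P {\<omega>. N \<le> Z \<omega>} \<le> Ehat (\<lambda>\<omega>. huber N (Z \<omega>)) / N\<^sup>2"
proof -
  interpret prob_space P using P by (simp add: dominated_probabilities_def)
  have sp: "space P = UNIV" and sets: "sets P = sigma_rv H"
    using P by (auto simp: dominated_probabilities_def)
  have hub: "(\<lambda>\<omega>. huber N (Z \<omega>)) \<in> H" using Z N by (intro huber_mem) auto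
  have int: "integrable P (\<lambda>\<omega>. huber N (Z \<omega>))"
    and le: "integral\<^sup>L P (\<lambda>\<omega>. huber N (Z \<omega>)) \<le> Ehat (\<lambda>\<omega>. huber N (Z \<omega>))"
    using P hub by (auto simp: dominated_probabilities_def dominated_expectations_def)
  have "measure P {\<omega>. N \<le> Z \<omega>} \<le> measure P {\<omega>. N\<^sup>2 \<le> huber N (Z \<omega>)}"
    using N huber_ge_square superlevel_sets[OF sp sets hub] by (intro finite_measure_mono) auto
  also have "\<dots> \<le> integral\<^sup>L P (\<lambda>\<omega>. huber N (Z \<omega>)) / N\<^sup>2"
    using integral_Markov_inequality_measure[OF int sets.empty_sets, of "N\<^sup>2"] N huber_nonneg
    by (simp add: sp)
  also have "\<dots> \<le> Ehat (\<lambda>\<omega>. huber N (Z \<omega>)) / N\<^sup>2"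
    by (intro divide_right_mono le) simp
  finally show ?thesis .
qed

lemma window_tail:
  assumes P: "P \<in> dominated_probabilities H Ehat" and "t > 0" "finite J" "J \<subseteq> {1..}"
  shows "measure P {\<omega>. t \<le> (\<Sum>j\<in>J. \<bar>proj p \<mu> j \<omega>\<bar>)} \<le> (real (card J))\<^sup>2 * moment p \<mu> / t\<^sup>2"
  using markov_huber[OF P sum_abs_proj_mem[OF assms(4)] assms(2), of p \<mu>]
    divide_right_mono[OF Ehat_huber_sum[of t J p \<mu>], of "t\<^sup>2"] assms by simp

text \<open>Nothing is used about the dependence between different classes: Jensen's inequality over
  the \<open>r\<close> classes reduces the claim to the bound for a single one. The block length
  cancels in the result.\<close>

lemma sum_tail:
  assumes P: "P \<in> dominated_probabilities H Ehat" and "\<epsilon> > 0" "m \<ge> 1" "r \<ge> 1"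
    and neg: "Ehat (\<lambda>\<omega>. \<Sum>j=1..m. proj p \<mu> j \<omega>) \<le> 0"
  shows "measure P {\<omega>. \<epsilon> * real (m * r ^ 3) \<le> (\<Sum>j=1..m * r ^ 3. proj p \<mu> j \<omega>)}
    \<le> moment p \<mu> / \<epsilon>\<^sup>2 * (1 / (real r)\<^sup>2)
      + 2 * c * (norm p + 1) / \<epsilon> * ((real r)\<^sup>2 * exp (- \<alpha> * real r))"
proof -
  \<comment> \<open>The threshold for the mean of the \<open>r\<close> class sums, that is
    \<open>\<epsilon> * real (m * r ^ 3)\<close> divided by \<open>r\<close>.\<close>
  define N where "N = \<epsilon> * real m * (real r)\<^sup>2"
  have N: "N > 0" using assms by (simp add: N_def)
  define T where "T i \<omega> = (\<Sum>j\<in>block_class m r i (r\<^sup>2). proj p \<mu> j \<omega>)" for i \<omega>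
  define D where "D = (real r)\<^sup>2 * ((real m)\<^sup>2 * moment p \<mu>
        + c * (2 * N * (real m * (real r)\<^sup>2) * (norm p + 1)) * exp (- \<alpha> * real r))"
  have T: "T i \<in> H" for i
    unfolding T_def by (rule sum_proj_mem) (auto simp: block_class_def block_def)
  have hT: "(\<lambda>\<omega>. huber N (T i \<omega>)) \<in> H" for i
    using T N by (intro huber_mem) auto
  have ET: "Ehat (\<lambda>\<omega>. huber N (T i \<omega>)) \<le> D" for i
    using Ehat_huber_block_class[where k = "r\<^sup>2" and q = "r\<^sup>2" and i = i, OF N assms(3,4) order_refl neg]
    by (simp add: T_def D_def)
  have r0: "real r > 0" using assms by simp
  have total: "(\<Sum>j=1..m * r ^ 3. proj p \<mu> j \<omega>) = (\<Sum>i<r. T i \<omega>)" for \<omega>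
    unfolding T_def sum_block_classes[OF assms(3,4)] by (simp add: power2_eq_square power3_eq_cube mult_ac)
  have mem: "(\<lambda>\<omega>. \<Sum>i<r. (1 / real r) * T i \<omega>) \<in> H"
    by (intro sum_mem scale_mem T)
  have "{\<omega>. \<epsilon> * real (m * r ^ 3) \<le> (\<Sum>j=1..m * r ^ 3. proj p \<mu> j \<omega>)}
      = {\<omega>. N \<le> (\<Sum>i<r. (1 / real r) * T i \<omega>)}"
    unfolding total sum_distrib_left[symmetric] using r0
    by (auto simp: N_def field_simps power2_eq_square power3_eq_cube)
  then have "measure P {\<omega>. \<epsilon> * real (m * r ^ 3) \<le> (\<Sum>j=1..m * r ^ 3. proj p \<mu> j \<omega>)}
      \<le> Ehat (\<lambda>\<omega>. huber N (\<Sum>i<r. (1 / real r) * T i \<omega>)) / N\<^sup>2"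
    using markov_huber[OF P mem N] by simp
  also have "\<dots> \<le> D / N\<^sup>2"
  proof (rule divide_right_mono)
    have "Ehat (\<lambda>\<omega>. huber N (\<Sum>i<r. (1 / real r) * T i \<omega>))
        \<le> Ehat (\<lambda>\<omega>. (1 / real r) * (\<Sum>i<r. huber N (T i \<omega>)))"
    proof (intro Ehat_mono huber_mem mem scale_mem sum_mem hT)
      fix \<omega>
      show "huber N (\<Sum>i<r. (1 / real r) * T i \<omega>) \<le> (1 / real r) * (\<Sum>i<r. huber N (T i \<omega>))"
        using huber_sum[of N "{..<r}" "\<lambda>i. (1 / real r) * T i \<omega>"] N r0
        by (simp add: lessThan_empty_iff)
    qed (use N T in auto)
    also have "\<dots> = (1 / real r) * Ehat (\<lambda>\<omega>. \<Sum>i<r. huber N (T i \<omega>))"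
      by (intro Ehat_scale sum_mem hT) simp
    also have "\<dots> \<le> (1 / real r) * (\<Sum>i<r. D)"
      by (intro mult_left_mono order_trans[OF Ehat_sum sum_mono] hT ET) simp
    also have "\<dots> = D" using r0 by simp
    finally show "Ehat (\<lambda>\<omega>. huber N (\<Sum>i<r. (1 / real r) * T i \<omega>)) \<le> D" .
  qed simp
  also have "D / N\<^sup>2 = moment p \<mu> / \<epsilon>\<^sup>2 * (1 / (real r)\<^sup>2)
      + 2 * c * (norm p + 1) / \<epsilon> * ((real r)\<^sup>2 * exp (- \<alpha> * real r))"
    using r0 assms by (simp add: D_def N_def field_simps power2_eq_square)
  finally show ?thesis .
qed

text \<open>Borel-Cantelli controls the sums at the times m r^3. The gap after such a time has order
  r^2 indices, so its sum of absolute values exceeds a multiple of r^3 with probability of order r^4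
  / r^6, which is summable too.\<close>

lemma AE_sum_proj_le:
  assumes P: "P \<in> dominated_probabilities H Ehat" and "\<epsilon> > 0" "m \<ge> 1"
    and neg: "Ehat (\<lambda>\<omega>. \<Sum>j=1..m. proj p \<mu> j \<omega>) \<le> 0"
  shows "AE \<omega> in P. \<forall>\<^sub>F n in sequentially. (\<Sum>j=1..n. proj p \<mu> j \<omega>) \<le> 2 * \<epsilon> * real n"
proof -
  interpret prob_space P using P by (simp add: dominated_probabilities_def)
  have sp: "space P = UNIV" and sets: "sets P = sigma_rv H"
    using P by (auto simp: dominated_probabilities_def)
  define J where "J r = {m * r ^ 3 + 1..m * Suc r ^ 3}" for r
  define A where "A r = {\<omega>. \<epsilon> * real (m * r ^ 3) \<le> (\<Sum>j=1..m * r ^ 3. proj p \<mu> j \<omega>)}" for r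
  define B where "B r = {\<omega>. \<epsilon> * real (m * r ^ 3) \<le> (\<Sum>j\<in>J r. \<bar>proj p \<mu> j \<omega>\<bar>)}" for r
  have A: "A r \<in> sets P" and B: "B r \<in> sets P" for r
    unfolding A_def B_def J_def by (intro superlevel_sets[OF sp sets] sum_proj_mem sum_abs_proj_mem; auto)+
  \<comment> \<open>(r + 1)^3 - r^3 = 3 r^2 + 3 r + 1 is at most 7 r^2 for r \<ge> 1.\<close>
  have cardJ: "real (card (J r)) \<le> 7 * real m * (real r)\<^sup>2" if "r \<ge> 1" for r
  proof -
    have "real (card (J r)) = real m * (real (Suc r) ^ 3 - real r ^ 3)"
      by (simp add: J_def of_nat_diff power_mono algebra_simps)
    also have "\<dots> \<le> real m * (7 * (real r)\<^sup>2)"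
    proof (rule mult_left_mono)
      have "1 \<le> real r" using that by simp
      then have "3 * (real r)\<^sup>2 + 3 * real r + 1 \<le> 7 * (real r)\<^sup>2"
        using mult_left_mono[of 1 "real r" "real r"] unfolding power2_eq_square by linarith
      moreover have "real (Suc r) ^ 3 - real r ^ 3 = 3 * (real r)\<^sup>2 + 3 * real r + 1"
        by (simp add: power2_eq_square power3_eq_cube algebra_simps)
      ultimately show "real (Suc r) ^ 3 - real r ^ 3 \<le> 7 * (real r)\<^sup>2" by simp
    qed simp
    finally show ?thesis by (simp add: mult_ac)
  qed
  \<comment> \<open>The factor 50 collects 1 from \<open>A r\<close> and 49 = 7^2 from
    \<open>B r\<close>.\<close>
  define bound where "bound r = (50 * moment p \<mu> / \<epsilon>\<^sup>2) * (1 / (real r)\<^sup>2)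
      + 2 * c * (norm p + 1) / \<epsilon> * ((real r)\<^sup>2 * exp (- \<alpha> * real r))" for r
  have AB: "measure P (A r \<union> B r) \<le> bound r" if "r \<ge> 1" for r
  proof -
    have pos: "\<epsilon> * real (m * r ^ 3) > 0" using assms that by simp
    have "measure P (A r \<union> B r) \<le> measure P (A r) + measure P (B r)"
      by (intro measure_Un_le A B)
    also have "measure P (B r) \<le> (real (card (J r)))\<^sup>2 * moment p \<mu> / (\<epsilon> * real (m * r ^ 3))\<^sup>2"
      unfolding B_def using pos by (intro window_tail[OF P]) (auto simp: J_def)
    also have "\<dots> \<le> (7 * real m * (real r)\<^sup>2)\<^sup>2 * moment p \<mu> / (\<epsilon> * real (m * r ^ 3))\<^sup>2"
      using cardJ[OF that] moment_nonneg
      by (intro divide_right_mono mult_right_mono power_mono) auto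
    also have "\<dots> = (49 * moment p \<mu> / \<epsilon>\<^sup>2) * (1 / (real r)\<^sup>2)"
      using assms that by (simp add: field_simps power2_eq_square power3_eq_cube)
    also have "measure P (A r) \<le> moment p \<mu> / \<epsilon>\<^sup>2 * (1 / (real r)\<^sup>2)
      + 2 * c * (norm p + 1) / \<epsilon> * ((real r)\<^sup>2 * exp (- \<alpha> * real r))"
      unfolding A_def by (rule sum_tail[OF P assms(2,3) that neg])
    finally show ?thesis by (simp add: bound_def add_divide_distrib)
  qed
  have "summable (\<lambda>r. (real r)\<^sup>2 * exp (- \<alpha> * real r))"
  proof (rule summable_comparison_test_bigo)
    show "summable (\<lambda>r. norm (1 / (real r)\<^sup>2))"
      using inverse_power_summable[of 2, where 'a = real] by (simp add: field_simps)
    show "(\<lambda>r. (real r)\<^sup>2 * exp (- \<alpha> * real r)) \<in> O(\<lambda>r. 1 / (real r)\<^sup>2)"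
      using \<alpha>_pos by real_asymp
  qed
  then have "summable bound"
    unfolding bound_def using inverse_power_summable[of 2, where 'a = real]
    by (intro summable_add summable_mult) (simp_all add: field_simps)
  then have "summable (\<lambda>r. measure P (A r \<union> B r))"
    using AB by (intro summable_comparison_test[of "\<lambda>r. measure P (A r \<union> B r)" bound]) auto
  then have "AE \<omega> in P. \<forall>\<^sub>F r in sequentially. \<omega> \<in> space P - (A r \<union> B r)"
    using A B by (intro borel_cantelli_AE1) (auto simp: less_top[symmetric])
  then show ?thesis
  proof (rule AE_mp, intro AE_I2 impI)
    fix \<omega> assume "\<forall>\<^sub>F r in sequentially. \<omega> \<in> space P - (A r \<union> B r)"
    then obtain R where R: "\<And>r. r \<ge> R \<Longrightarrow> \<omega> \<notin> A r \<and> \<omega> \<notin> B r"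
      by (auto simp: eventually_sequentially)
    show "\<forall>\<^sub>F n in sequentially. (\<Sum>j=1..n. proj p \<mu> j \<omega>) \<le> 2 * \<epsilon> * real n"
      unfolding eventually_sequentially
    proof (intro exI[of _ "m * R ^ 3"] allI impI)
      fix n assume n: "n \<ge> m * R ^ 3"
      \<comment> \<open>Bounded candidates ensure that the greatest one exists.\<close>
      have bnd: "r \<le> n" if "m * r ^ 3 \<le> n" for r
      proof -
        have "r \<le> r ^ 3" by (cases "r = 0") (simp_all add: self_le_power)
        also have "\<dots> \<le> m * r ^ 3" using assms(3) by simp
        finally show ?thesis using that by simp
      qed
      define r where "r = (GREATEST r. m * r ^ 3 \<le> n)"
      have r: "m * r ^ 3 \<le> n" and R_le: "R \<le> r" and max: "n < m * Suc r ^ 3"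
      proof -
        show "m * r ^ 3 \<le> n" unfolding r_def by (rule GreatestI_nat[where P = "\<lambda>r. m * r ^ 3 \<le> n", OF n bnd])
        show "R \<le> r" unfolding r_def by (rule Greatest_le_nat[where P = "\<lambda>r. m * r ^ 3 \<le> n", OF n bnd])
        show "n < m * Suc r ^ 3"
        proof (rule ccontr)
          assume "\<not> n < m * Suc r ^ 3"
          then have "Suc r \<le> r" unfolding r_def by (intro Greatest_le_nat[where P = "\<lambda>r. m * r ^ 3 \<le> n", OF _ bnd]) auto
          then show False by simp
        qed
      qed
      \<comment> \<open>Cut at the last time m r^3 up to \<open>n\<close>. The rest is enlarged to
        the whole gap, which absolute values permit.\<close>
      have "(\<Sum>j=1..n. proj p \<mu> j \<omega>)
          = (\<Sum>j=1..m * r ^ 3. proj p \<mu> j \<omega>) + (\<Sum>j\<in>{m * r ^ 3 + 1..n}. proj p \<mu> j \<omega>)"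
        using r by (subst sum.union_disjoint[symmetric]) (auto intro!: sum.cong)
      also have "(\<Sum>j\<in>{m * r ^ 3 + 1..n}. proj p \<mu> j \<omega>) \<le> (\<Sum>j\<in>{m * r ^ 3 + 1..n}. \<bar>proj p \<mu> j \<omega>\<bar>)"
        by (intro sum_mono) simp
      also have "\<dots> \<le> (\<Sum>j\<in>J r. \<bar>proj p \<mu> j \<omega>\<bar>)"
        using max by (intro sum_mono2) (auto simp: J_def)
      also have "\<dots> \<le> \<epsilon> * real (m * r ^ 3)" using R[OF R_le] by (simp add: B_def)
      also have "(\<Sum>j=1..m * r ^ 3. proj p \<mu> j \<omega>) \<le> \<epsilon> * real (m * r ^ 3)"
        using R[OF R_le] by (simp add: A_def)
      also have "\<epsilon> * real (m * r ^ 3) + \<epsilon> * real (m * r ^ 3) \<le> 2 * \<epsilon> * real n"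
        using mult_left_mono[OF of_nat_mono[OF r], of "2 * \<epsilon>"] assms(2) by linarith
      finally show "(\<Sum>j=1..n. proj p \<mu> j \<omega>) \<le> 2 * \<epsilon> * real n" by simp
    qed
  qed
qed

end

section \<open>Quasi-sure limit points of the means\<close>

text \<open>Bolzano-Weierstrass applied to the indices at which \<open>Q\<close> holds, so that
  \<open>Q\<close> survives along the convergent subsequence.\<close>

lemma frequently_limit_point:
  fixes x :: "nat \<Rightarrow> 'b :: euclidean_space"
  assumes "\<forall>\<^sub>F n in sequentially. norm (x n) \<le> B" and "\<exists>\<^sub>F n in sequentially. Q (x n)"
  obtains r l where "strict_mono r" "(\<lambda>k. x (r k)) \<longlonglongrightarrow> l" "\<And>k. Q (x (r k))"
proof -
  have "\<exists>\<^sub>F n in sequentially. norm (x n) \<le> B \<and> Q (x n)"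
    using frequently_eventually_conj[OF assms(2,1)] by (simp add: conj_commute)
  then have "infinite {n. norm (x n) \<le> B \<and> Q (x n)}"
    by (simp add: cofinite_eq_sequentially[symmetric] frequently_cofinite)
  from infinite_enumerate[OF this] obtain s :: "nat \<Rightarrow> nat"
    where "strict_mono s" "\<forall>n. s n \<in> {n. norm (x n) \<le> B \<and> Q (x n)}" by blast
  then have s: "strict_mono s" "\<And>n. norm (x (s n)) \<le> B" "\<And>n. Q (x (s n))" by auto
  have "bounded (range (x \<circ> s))" using s(2) by (auto simp: bounded_iff)
  then obtain l t where t: "strict_mono t" "((x \<circ> s) \<circ> t) \<longlonglongrightarrow> l"
    using bounded_imp_convergent_subsequence by blast
  show thesis
    using s t strict_mono_o[OF s(1) t(1)] by (intro that[of "s \<circ> t" l]) (auto simp: comp_def)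
qed

lemma tendsto_l1norm_diff:
  assumes "(f \<longlongrightarrow> l) F"
  shows "((\<lambda>k. l1norm (f k - l)) \<longlongrightarrow> 0) F"
proof -
  have "((\<lambda>k. l1norm (f k - l)) \<longlongrightarrow> (\<Sum>i\<in>UNIV. \<bar>(l - l) $ i\<bar>)) F"
    unfolding l1norm_def by (intro tendsto_intros assms)
  then show ?thesis by simp
qed

lemma (in sublinear_space) dominated_expectation_add:
  assumes "E \<in> dominated_expectations H Ehat" "Z \<in> H" "W \<in> H"
  shows "E (\<lambda>\<omega>. a * Z \<omega> + b * W \<omega>) = a * E Z + b * E W"
  using assms unfolding dominated_expectations_def linear_expectation_def by blast

lemma (in sublinear_space) dominated_expectation_scale:
  assumes "E \<in> dominated_expectations H Ehat" "Z \<in> H"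
  shows "E (\<lambda>\<omega>. a * Z \<omega>) = a * E Z"
  using dominated_expectation_add[OF assms(1,2,2), of a 0] by simp

lemma (in sublinear_space) dominated_expectation_sum:
  assumes E: "E \<in> dominated_expectations H Ehat" and "\<And>j. j \<in> J \<Longrightarrow> Z j \<in> H"
  shows "E (\<lambda>\<omega>. \<Sum>j\<in>J. Z j \<omega>) = (\<Sum>j\<in>J. E (Z j))"
proof -
  have zero: "E (\<lambda>\<omega>. 0) = 0"
    using dominated_expectation_scale[OF E zero_mem, of 0] by simp
  show ?thesis using assms(2)
  proof (induction J rule: infinite_finite_induct)
    case (insert j J)
    then show ?case
      using dominated_expectation_add[OF E, of "Z j" "\<lambda>\<omega>. \<Sum>j\<in>J. Z j \<omega>" 1 1] by (simp add: sum_mem)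
  qed (simp_all add: zero)
qed

section \<open>Support functions and typical sample points\<close>

context mixing_sequence
begin

definition partial_sum :: "nat \<Rightarrow> 'a \<Rightarrow> real ^ 'd" where
  "partial_sum n \<omega> = (\<Sum>k=1..n. X k \<omega>)"

text \<open>The h_m of the overview; by Hahn-Banach, the support function of
  \<open>Gamma_mean H Ehat X m\<close>.\<close>

definition support :: "nat \<Rightarrow> real ^ 'd \<Rightarrow> real" where
  "support m p = Ehat (\<lambda>\<omega>. p \<bullet> partial_sum m \<omega>) / real m"

lemma inner_partial_sum_mem: "(\<lambda>\<omega>. p \<bullet> partial_sum n \<omega>) \<in> H"
  unfolding partial_sum_def inner_sum_right by (intro sum_mem inner_mem) auto

text \<open>Centring at \<open>support m p\<close> is exactly what gives the first \<open>m\<close>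
  terms a nonpositive expected sum.\<close>

lemma AE_inner_partial_sum_le:
  assumes P: "P \<in> dominated_probabilities H Ehat" and "m \<ge> 1" "\<epsilon> > 0"
  shows "AE \<omega> in P. \<forall>\<^sub>F n in sequentially. p \<bullet> partial_sum n \<omega> \<le> real n * (support m p + \<epsilon>)"
proof -
  have sum_proj: "(\<Sum>j=1..n. proj p (support m p) j \<omega>) = p \<bullet> partial_sum n \<omega> - real n * support m p" for n \<omega>
    by (simp add: proj_def partial_sum_def inner_sum_right sum_subtractf)
  have "Ehat (\<lambda>\<omega>. \<Sum>j=1..m. proj p (support m p) j \<omega>)
      \<le> Ehat (\<lambda>\<omega>. p \<bullet> partial_sum m \<omega>) + - (real m * support m p)"
    unfolding sum_proj
    by (intro Ehat_le_add_const diff_mem inner_partial_sum_mem const_mem) simp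
  also have "\<dots> = 0" using assms(2) by (simp add: support_def)
  finally have "AE \<omega> in P. \<forall>\<^sub>F n in sequentially.
      (\<Sum>j=1..n. proj p (support m p) j \<omega>) \<le> 2 * (\<epsilon> / 2) * real n"
    using assms by (intro AE_sum_proj_le[OF P]) auto
  then show ?thesis unfolding sum_proj by (simp add: algebra_simps)
qed

text \<open>Hahn-Banach is applied to the mean of the first \<open>m\<close> vectors for each
  \<open>m\<close> separately; the expectation found may depend on \<open>m\<close>.\<close>

lemma in_Gamma_star:
  assumes l: "\<And>m p. m \<ge> 1 \<Longrightarrow> p \<bullet> l \<le> support m p"
  shows "l \<in> Gamma_star H Ehat X"
  unfolding Gamma_star_def
proof
  fix m :: nat assume "m \<in> {1..}"
  then have m: "m \<ge> 1" by simp
  define Z where "Z \<omega> = (1 / real m) *\<^sub>R partial_sum m \<omega>" for \<omega>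
  have comp: "(\<lambda>\<omega>. Z \<omega> $ i) = (\<lambda>\<omega>. (1 / real m) * (\<Sum>k=1..m. X k \<omega> $ i))" for i
    by (simp add: Z_def partial_sum_def)
  have sum: "(\<lambda>\<omega>. \<Sum>k=1..m. X k \<omega> $ i) \<in> H" for i
    by (intro sum_mem component_mem) auto
  have Z: "(\<lambda>\<omega>. Z \<omega> $ i) \<in> H" for i
    unfolding comp by (intro scale_mem sum)
  have "Ehat (\<lambda>\<omega>. p \<bullet> Z \<omega>) = support m p" for p
    using Ehat_scale[OF inner_partial_sum_mem, of "1 / real m"] by (simp add: Z_def support_def)
  then obtain E where E: "E \<in> dominated_expectations H Ehat" "vec_expectation E Z = l"
    using ex_dominated_expectation[OF Z, of l] l[OF m] by metis
  have "E (\<lambda>\<omega>. Z \<omega> $ i) = (1 / real m) * (\<Sum>k=1..m. E (\<lambda>\<omega>. X k \<omega> $ i))" for i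
    unfolding comp dominated_expectation_scale[OF E(1) sum]
    by (subst dominated_expectation_sum[OF E(1)]) (auto intro: component_mem)
  then have "l = (1 / real m) *\<^sub>R (\<Sum>k=1..m. vec_expectation E (X k))"
    using E(2) by (simp add: vec_eq_iff vec_expectation_def)
  then show "l \<in> Gamma_mean H Ehat X m"
    using E(1) unfolding Gamma_mean_def by blast
qed

text \<open>Subadditivity and homogeneity make it convex, and a finite convex function on a
  finite-dimensional space is continuous.\<close>

lemma continuous_on_support: "continuous_on UNIV (support m)"
proof (rule convex_on_continuous[OF open_UNIV], rule convex_onI)
  fix t :: real and p q :: "real ^ 'd" assume t: "0 < t" "t < 1"
  have "Ehat (\<lambda>\<omega>. ((1 - t) *\<^sub>R p + t *\<^sub>R q) \<bullet> partial_sum m \<omega>)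
      = Ehat (\<lambda>\<omega>. (1 - t) * (p \<bullet> partial_sum m \<omega>) + t * (q \<bullet> partial_sum m \<omega>))"
    by (simp add: inner_add_left)
  also have "\<dots> \<le> Ehat (\<lambda>\<omega>. (1 - t) * (p \<bullet> partial_sum m \<omega>)) + Ehat (\<lambda>\<omega>. t * (q \<bullet> partial_sum m \<omega>))"
    by (intro Ehat_add scale_mem inner_partial_sum_mem)
  also have "\<dots> = (1 - t) * Ehat (\<lambda>\<omega>. p \<bullet> partial_sum m \<omega>) + t * Ehat (\<lambda>\<omega>. q \<bullet> partial_sum m \<omega>)"
    using t by (simp add: Ehat_scale inner_partial_sum_mem)
  finally show "support m ((1 - t) *\<^sub>R p + t *\<^sub>R q) \<le> (1 - t) * support m p + t * support m q"
    unfolding support_def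
    by (simp add: divide_right_mono add_divide_distrib[symmetric])
qed simp

text \<open>A single event for all dominated probabilities at once, as the capacity requires. With
  \<open>D\<close> countable and errors 1/(k+1) it is a countable intersection, hence
  measurable.\<close>

definition typical :: "(real ^ 'd) set \<Rightarrow> 'a set" where
  "typical D = {\<omega>. \<forall>p\<in>D. \<forall>m\<in>{1..}. \<forall>k::nat. \<forall>\<^sub>F n in sequentially.
     p \<bullet> partial_sum n \<omega> \<le> real n * (support m p + 1 / real (Suc k))}"

lemma typical_quasi_sure:
  assumes "countable D"
  shows "typical D \<in> sigma_rv H" and "upper_capacity H Ehat (- typical D) = 0"
proof -
  \<comment> \<open>Stated for any \<open>M\<close> carrying the right sets, to serve both the
    generated sigma-algebra and every dominated probability.\<close>
  have meas: "typical D \<in> sets M" if sp: "space M = UNIV" and sets: "sets M = sigma_rv H" for M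
  proof -
    have [measurable]: "(\<lambda>\<omega>. p \<bullet> partial_sum n \<omega>) \<in> borel_measurable M" for p n
      by (rule measurable_H[OF sp sets inner_partial_sum_mem])
    have "{\<omega> \<in> space M. \<forall>p\<in>D. \<forall>m\<in>{1..}. \<forall>k::nat. \<exists>n0. \<forall>n\<ge>n0.
       p \<bullet> partial_sum n \<omega> \<le> real n * (support m p + 1 / real (Suc k))} \<in> sets M"
      using assms by measurable
    then show ?thesis by (simp add: typical_def sp eventually_sequentially)
  qed
  have "sets (sigma UNIV {Z -` B | Z B. Z \<in> H \<and> B \<in> sets borel}) = sigma_rv H"
    by (simp add: sigma_rv_def)
  then show "typical D \<in> sigma_rv H"
    using meas[of "sigma UNIV {Z -` B | Z B. Z \<in> H \<and> B \<in> sets borel}"] by simp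
  have "emeasure P (- typical D) = 0" if P: "P \<in> dominated_probabilities H Ehat" for P
  proof -
    have sp: "space P = UNIV" and sets: "sets P = sigma_rv H"
      using P by (auto simp: dominated_probabilities_def)
    have "AE \<omega> in P. \<forall>p\<in>D. \<forall>m\<in>{1..}. \<forall>k::nat. \<forall>\<^sub>F n in sequentially.
        p \<bullet> partial_sum n \<omega> \<le> real n * (support m p + 1 / real (Suc k))"
      using assms
      by (auto simp: AE_ball_countable AE_all_countable intro!: AE_inner_partial_sum_le[OF P])
    then have "AE \<omega> in P. \<omega> \<notin> - typical D" by (simp add: typical_def)
    moreover have "- typical D \<in> sets P"
      using sets.compl_sets[OF meas[OF sp sets]] by (simp add: sp Compl_eq_Diff_UNIV)
    ultimately show ?thesis using AE_iff_null_sets[of "- typical D" P] by auto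
  qed
  then show "upper_capacity H Ehat (- typical D) = 0"
    unfolding upper_capacity_def by (auto intro!: antisym SUP_least)
qed

lemma typical_inner_mean_le:
  assumes "\<omega> \<in> typical D" "p \<in> D" "m \<ge> 1" "\<epsilon> > 0"
  shows "\<forall>\<^sub>F n in sequentially. p \<bullet> ((1 / real n) *\<^sub>R partial_sum n \<omega>) \<le> support m p + \<epsilon>"
proof -
  obtain k where k: "1 / real (Suc k) < \<epsilon>" using nat_approx_posE[OF assms(4)] by blast
  have "\<forall>\<^sub>F n in sequentially. p \<bullet> partial_sum n \<omega> \<le> real n * (support m p + 1 / real (Suc k))"
    using assms unfolding typical_def by auto
  then show ?thesis
    using eventually_gt_at_top[of 0]
  proof eventually_elim
    case (elim n)
    then have "p \<bullet> ((1 / real n) *\<^sub>R partial_sum n \<omega>) \<le> support m p + 1 / real (Suc k)"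
      by (simp add: field_simps)
    then show ?case using k by simp
  qed
qed

text \<open>In the limit the inequalities hold for p in \<open>D\<close>. The directions violating
  one of them form an open set by continuity of \<open>support m\<close>; if nonempty, it would meet
  the dense set \<open>D\<close>.\<close>

lemma typical_limit_point:
  assumes \<omega>: "\<omega> \<in> typical D" and r: "strict_mono r"
    and lim: "(\<lambda>k. (1 / real (r k)) *\<^sub>R partial_sum (r k) \<omega>) \<longlonglongrightarrow> l"
    and dense: "\<And>U. open U \<Longrightarrow> U \<noteq> {} \<Longrightarrow> \<exists>p\<in>D. p \<in> U"
  shows "l \<in> Gamma_star H Ehat X"
proof (rule in_Gamma_star)
  fix m :: nat and p assume m: "m \<ge> 1"
  have D: "p \<bullet> l \<le> support m p" if "p \<in> D" for p
  proof (rule field_le_epsilon)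
    fix \<epsilon> :: real assume "\<epsilon> > 0"
    then show "p \<bullet> l \<le> support m p + \<epsilon>"
      using eventually_subseq[OF r typical_inner_mean_le[OF \<omega> that m]] lim
      by (intro tendsto_upperbound[OF tendsto_inner[OF tendsto_const lim]]) auto
  qed
  have "open {p. support m p < p \<bullet> l}"
    using continuous_on_support by (intro open_Collect_less continuous_intros)
  then show "p \<bullet> l \<le> support m p"
    using dense[of "{p. support m p < p \<bullet> l}"] D by (metis (mono_tags) empty_iff mem_Collect_eq not_le)
qed

text \<open>The signed unit vectors, with m = 1 and error 1, bound every coordinate from both
  sides.\<close>

lemma typical_bounded:
  assumes \<omega>: "\<omega> \<in> typical D" and axes: "\<And>i. axis i 1 \<in> D" "\<And>i. - axis i 1 \<in> D"
  obtains B where "\<forall>\<^sub>F n in sequentially. norm ((1 / real n) *\<^sub>R partial_sum n \<omega>) \<le> B"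
proof -
  define x where "x n = (1 / real n) *\<^sub>R partial_sum n \<omega>" for n
  define b where "b i = \<bar>support 1 (axis i 1) + 1\<bar> + \<bar>support 1 (- axis i 1) + 1\<bar>" for i :: 'd
  have "\<forall>\<^sub>F n in sequentially. \<forall>i. \<bar>x n $ i\<bar> \<le> b i"
  proof (rule eventually_all_finite)
    fix i
    show "\<forall>\<^sub>F n in sequentially. \<bar>x n $ i\<bar> \<le> b i"
      using typical_inner_mean_le[OF \<omega> axes(1)[of i] order_refl zero_less_one]
        typical_inner_mean_le[OF \<omega> axes(2)[of i] order_refl zero_less_one]
      unfolding x_def[symmetric]
      by eventually_elim (auto simp: inner_axis' b_def)
  qed
  then have "\<forall>\<^sub>F n in sequentially. norm (x n) \<le> (\<Sum>i\<in>UNIV. b i)"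
    by eventually_elim (auto intro: order_trans[OF norm_le_l1_cart] sum_mono)
  then show thesis unfolding x_def by (rule that)
qed

text \<open>Already the points of \<open>Gamma_mean H Ehat X 1\<close> obey these bounds.\<close>

lemma Gamma_star_bounds:
  assumes "l \<in> Gamma_star H Ehat X"
  shows "- Ehat (\<lambda>\<omega>. - (X 1 \<omega> $ i)) \<le> l $ i" and "l $ i \<le> Ehat (\<lambda>\<omega>. X 1 \<omega> $ i)"
proof -
  have "l \<in> Gamma_mean H Ehat X 1" using assms by (simp add: Gamma_star_def)
  then obtain E where E: "E \<in> dominated_expectations H Ehat" and l: "l $ i = E (\<lambda>\<omega>. X 1 \<omega> $ i)"
    by (auto simp: Gamma_mean_def vec_expectation_def)
  have dom: "E Z \<le> Ehat Z" if "Z \<in> H" for Z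
    using E that by (simp add: dominated_expectations_def)
  have X1: "(\<lambda>\<omega>. X 1 \<omega> $ i) \<in> H" by (rule component_mem) simp
  show "l $ i \<le> Ehat (\<lambda>\<omega>. X 1 \<omega> $ i)" using dom[OF X1] l by simp
  show "- Ehat (\<lambda>\<omega>. - (X 1 \<omega> $ i)) \<le> l $ i"
    using dom[OF uminus_mem[OF X1]] dominated_expectation_scale[OF E X1, of "-1"] l by simp
qed

text \<open>The source of every contradiction below: what happens to the means infinitely often also
  happens along a subsequence converging to a point of \<open>Gamma_star H Ehat X\<close>.\<close>

lemma typical_frequently:
  assumes \<omega>: "\<omega> \<in> typical D"
    and axes: "\<And>i. axis i 1 \<in> D" "\<And>i. - axis i 1 \<in> D"
    and dense: "\<And>U. open U \<Longrightarrow> U \<noteq> {} \<Longrightarrow> \<exists>p\<in>D. p \<in> U"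
    and Q: "\<exists>\<^sub>F n in sequentially. Q ((1 / real n) *\<^sub>R partial_sum n \<omega>)"
  obtains r l where "(\<lambda>k. (1 / real (r k)) *\<^sub>R partial_sum (r k) \<omega>) \<longlonglongrightarrow> l"
    and "l \<in> Gamma_star H Ehat X" and "\<And>k. Q ((1 / real (r k)) *\<^sub>R partial_sum (r k) \<omega>)"
proof -
  obtain B where "\<forall>\<^sub>F n in sequentially. norm ((1 / real n) *\<^sub>R partial_sum n \<omega>) \<le> B"
    using typical_bounded[OF \<omega> axes] .
  from frequently_limit_point[of "\<lambda>n. (1 / real n) *\<^sub>R partial_sum n \<omega>", OF this Q]
  obtain r l where "strict_mono r" "(\<lambda>k. (1 / real (r k)) *\<^sub>R partial_sum (r k) \<omega>) \<longlonglongrightarrow> l"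
    "\<And>k. Q ((1 / real (r k)) *\<^sub>R partial_sum (r k) \<omega>)" by blast
  with typical_limit_point[OF \<omega> this(1,2) dense] show thesis by (intro that)
qed

text \<open>A failure of any of the three claims is an event occurring infinitely often, so
  \<open>typical_frequently\<close> supplies a limit in \<open>Gamma_star H Ehat X\<close> that
  refutes it. That this set has a point at all thus comes from the failure itself.\<close>

lemma typical_conclusions:
  assumes \<omega>: "\<omega> \<in> typical D"
    and axes: "\<And>i. axis i 1 \<in> D" "\<And>i. - axis i 1 \<in> D"
    and dense: "\<And>U. open U \<Longrightarrow> U \<noteq> {} \<Longrightarrow> \<exists>p\<in>D. p \<in> U"
  shows "(\<lambda>n. dist_l1 ((1 / real n) *\<^sub>R partial_sum n \<omega>) (Gamma_star H Ehat X)) \<longlonglongrightarrow> 0"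
    and "(INF x\<in>Gamma_star H Ehat X. ereal (x $ i))
      \<le> liminf (\<lambda>n. ereal (((1 / real n) *\<^sub>R partial_sum n \<omega>) $ i))"
    and "limsup (\<lambda>n. ereal (((1 / real n) *\<^sub>R partial_sum n \<omega>) $ i))
      \<le> (SUP x\<in>Gamma_star H Ehat X. ereal (x $ i))"
proof -
  show "(\<lambda>n. dist_l1 ((1 / real n) *\<^sub>R partial_sum n \<omega>) (Gamma_star H Ehat X)) \<longlonglongrightarrow> 0"
  proof (rule order_tendstoI)
    fix a :: ereal assume "a < 0"
    moreover have "0 \<le> dist_l1 x S" for x S
      unfolding dist_l1_def by (rule INF_greatest) (simp add: l1norm_nonneg)
    ultimately show "\<forall>\<^sub>F n in sequentially. a < dist_l1 ((1 / real n) *\<^sub>R partial_sum n \<omega>) (Gamma_star H Ehat X)"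
      by (intro always_eventually allI) (rule less_le_trans)
  next
    fix a :: ereal assume a: "0 < a"
    show "\<forall>\<^sub>F n in sequentially. dist_l1 ((1 / real n) *\<^sub>R partial_sum n \<omega>) (Gamma_star H Ehat X) < a"
    proof (rule ccontr)
      assume "\<not> ?thesis"
      then have fq: "\<exists>\<^sub>F n in sequentially.
          \<not> dist_l1 ((1 / real n) *\<^sub>R partial_sum n \<omega>) (Gamma_star H Ehat X) < a"
        by (simp add: not_eventually)
      obtain r l where l: "l \<in> Gamma_star H Ehat X"
        and lim: "(\<lambda>k. (1 / real (r k)) *\<^sub>R partial_sum (r k) \<omega>) \<longlonglongrightarrow> l"
        and ge: "\<And>k. \<not> dist_l1 ((1 / real (r k)) *\<^sub>R partial_sum (r k) \<omega>) (Gamma_star H Ehat X) < a"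
        using typical_frequently[where Q = "\<lambda>x. \<not> dist_l1 x (Gamma_star H Ehat X) < a", OF \<omega> axes dense fq] by blast
      \<comment> \<open>The distance to the set is at most the distance to its point
        \<open>l\<close>, which tends to 0 along \<open>r\<close>.\<close>
      have "a \<le> ereal (l1norm ((1 / real (r k)) *\<^sub>R partial_sum (r k) \<omega> - l))" for k
        using ge[of k] INF_lower[OF l] unfolding dist_l1_def not_less by (rule order_trans)
      then have "a \<le> ereal 0"
        by (intro tendsto_lowerbound[OF tendsto_ereal[OF tendsto_l1norm_diff[OF lim]]]) auto
      with a show False by (metis leD zero_ereal_def)
    qed
  qed
  show "(INF x\<in>Gamma_star H Ehat X. ereal (x $ i))
      \<le> liminf (\<lambda>n. ereal (((1 / real n) *\<^sub>R partial_sum n \<omega>) $ i))"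
    unfolding le_Liminf_iff
  proof (intro allI impI, rule ccontr)
    fix y assume y: "y < (INF x\<in>Gamma_star H Ehat X. ereal (x $ i))"
      and "\<not> (\<forall>\<^sub>F n in sequentially. y < ereal (((1 / real n) *\<^sub>R partial_sum n \<omega>) $ i))"
    then have fq: "\<exists>\<^sub>F n in sequentially. \<not> y < ereal (((1 / real n) *\<^sub>R partial_sum n \<omega>) $ i)"
      by (simp add: not_eventually)
    obtain r l where l: "l \<in> Gamma_star H Ehat X"
      and lim: "(\<lambda>k. (1 / real (r k)) *\<^sub>R partial_sum (r k) \<omega>) \<longlonglongrightarrow> l"
      and le: "\<And>k. \<not> y < ereal (((1 / real (r k)) *\<^sub>R partial_sum (r k) \<omega>) $ i)"
      using typical_frequently[where Q = "\<lambda>x. \<not> y < ereal (x $ i)", OF \<omega> axes dense fq] by blast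
    have "ereal (l $ i) \<le> y"
      using le by (intro tendsto_upperbound[OF tendsto_ereal[OF tendsto_vec_nth[OF lim]]]) (auto simp: not_less)
    with y INF_lower[OF l, of "\<lambda>x. ereal (x $ i)"] show False by simp
  qed
  show "limsup (\<lambda>n. ereal (((1 / real n) *\<^sub>R partial_sum n \<omega>) $ i))
      \<le> (SUP x\<in>Gamma_star H Ehat X. ereal (x $ i))"
    unfolding Limsup_le_iff
  proof (intro allI impI, rule ccontr)
    fix y assume y: "y > (SUP x\<in>Gamma_star H Ehat X. ereal (x $ i))"
      and "\<not> (\<forall>\<^sub>F n in sequentially. y > ereal (((1 / real n) *\<^sub>R partial_sum n \<omega>) $ i))"
    then have fq: "\<exists>\<^sub>F n in sequentially. \<not> y > ereal (((1 / real n) *\<^sub>R partial_sum n \<omega>) $ i)"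
      by (simp add: not_eventually)
    obtain r l where l: "l \<in> Gamma_star H Ehat X"
      and lim: "(\<lambda>k. (1 / real (r k)) *\<^sub>R partial_sum (r k) \<omega>) \<longlonglongrightarrow> l"
      and le: "\<And>k. \<not> y > ereal (((1 / real (r k)) *\<^sub>R partial_sum (r k) \<omega>) $ i)"
      using typical_frequently[where Q = "\<lambda>x. \<not> y > ereal (x $ i)", OF \<omega> axes dense fq] by blast
    have "y \<le> ereal (l $ i)"
      using le by (intro tendsto_lowerbound[OF tendsto_ereal[OF tendsto_vec_nth[OF lim]]]) (auto simp: not_less)
    with y SUP_upper[OF l, of "\<lambda>x. ereal (x $ i)"] show False by simp
  qed
qed

end

section \<open>The three quasi-sure statements on one typical set\<close>

theorem theorem1p9:
  fixes H :: "('a \<Rightarrow> real) set"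
    and Ehat :: "('a \<Rightarrow> real) \<Rightarrow> real"
    and X :: "nat \<Rightarrow> 'a \<Rightarrow> real ^ 'd"
    and \<alpha> :: real
  assumes "rv_space H"
    and "sublinear_expectation H Ehat"
    and "regular_expectation H Ehat"
    and "\<And>k i. k \<ge> 1 \<Longrightarrow> (\<lambda>\<omega>. X k \<omega> $ i) \<in> H"
    and "stationary Ehat X"
    and "\<alpha> > 0"
    and "alpha_mixing \<alpha> Ehat X"
    and "(\<lambda>\<omega>. (l1norm (X 1 \<omega>))\<^sup>2) \<in> H"
  shows "quasi_surely H Ehat
           (\<lambda>\<omega>. (\<lambda>n. dist_l1 ((1 / real n) *\<^sub>R (\<Sum>k=1..n. X k \<omega>)) (Gamma_star H Ehat X))
                  \<longlonglongrightarrow> 0) \<and>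
         quasi_surely H Ehat
           (\<lambda>\<omega>. \<forall>l. (\<exists>r :: nat \<Rightarrow> nat. strict_mono r \<and>
                     (\<lambda>m. (1 / real (r m)) *\<^sub>R (\<Sum>k=1..r m. X k \<omega>)) \<longlonglongrightarrow> l)
                  \<longrightarrow> l \<in> Gamma_star H Ehat X) \<and>
         (CARD('d) = 1 \<longrightarrow> (\<forall>i :: 'd. quasi_surely H Ehat
           (\<lambda>\<omega>. ereal (- Ehat (\<lambda>\<omega>'. - (X 1 \<omega>' $ i))) \<le> (INF x\<in>Gamma_star H Ehat X. ereal (x $ i)) \<and>
                (INF x\<in>Gamma_star H Ehat X. ereal (x $ i))
                  \<le> liminf (\<lambda>n. ereal (((1 / real n) *\<^sub>R (\<Sum>k=1..n. X k \<omega>)) $ i)) \<and>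
                liminf (\<lambda>n. ereal (((1 / real n) *\<^sub>R (\<Sum>k=1..n. X k \<omega>)) $ i))
                  \<le> limsup (\<lambda>n. ereal (((1 / real n) *\<^sub>R (\<Sum>k=1..n. X k \<omega>)) $ i)) \<and>
                limsup (\<lambda>n. ereal (((1 / real n) *\<^sub>R (\<Sum>k=1..n. X k \<omega>)) $ i))
                  \<le> (SUP x\<in>Gamma_star H Ehat X. ereal (x $ i)) \<and>
                (SUP x\<in>Gamma_star H Ehat X. ereal (x $ i)) \<le> ereal (Ehat (\<lambda>\<omega>'. X 1 \<omega>' $ i)))))"
proof -
  from assms(7) obtain c where c: "c > 0" and mix: "\<And>\<Lambda>1 \<Lambda>2 \<phi> L.
      finite \<Lambda>1 \<and> \<Lambda>1 \<noteq> {} \<and> \<Lambda>1 \<subseteq> {1..} \<and> finite \<Lambda>2 \<and> \<Lambda>2 \<noteq> {} \<and> \<Lambda>2 \<subseteq> {1..} \<and>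
        Max \<Lambda>1 \<le> Min \<Lambda>2 \<and> L > 0 \<and> lipschitz_wrt dist_pair L \<phi> \<Longrightarrow>
        \<bar>Ehat (\<lambda>\<omega>. \<phi> (average X \<Lambda>1 \<omega>, average X \<Lambda>2 \<omega>)) -
         Ehat (\<lambda>\<omega>. Ehat (\<lambda>\<omega>'. \<phi> (average X \<Lambda>1 \<omega>, average X \<Lambda>2 \<omega>')))\<bar>
        \<le> c * L * exp (- \<alpha> * \<bar>real (Min \<Lambda>2) - real (Max \<Lambda>1)\<bar>)"
    unfolding alpha_mixing_def by (elim exE conjE) (rule that, assumption, meson)
  interpret mixing_sequence H Ehat X \<alpha> c
  proof unfold_locales
    show "rv_space H" "sublinear_expectation H Ehat" "stationary Ehat X" "\<alpha> > 0" "c > 0"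
      "(\<lambda>\<omega>. (l1norm (X 1 \<omega>))\<^sup>2) \<in> H"
      by (fact assms c)+
  qed (rule assms(4) mix; simp)+
  obtain D0 :: "(real ^ 'd) set" where D0: "countable D0"
    "\<And>U. open U \<Longrightarrow> U \<noteq> {} \<Longrightarrow> \<exists>p\<in>D0. p \<in> U"
    using countable_dense_setE by blast
  \<comment> \<open>Density serves the limit points, the adjoined signed unit vectors serve
    boundedness.\<close>
  define D where "D = D0 \<union> range (\<lambda>i. axis i 1) \<union> range (\<lambda>i. - axis i 1)"
  have countable: "countable D" using D0(1) by (simp add: D_def countable_finite)
  have axes: "axis i 1 \<in> D" "- axis i 1 \<in> D" for i by (auto simp: D_def)
  have dense: "\<exists>p\<in>D. p \<in> U" if "open U" "U \<noteq> {}" for U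
    using D0(2)[OF that] by (auto simp: D_def)
  have qs: "quasi_surely H Ehat Q" if "\<And>\<omega>. \<omega> \<in> typical D \<Longrightarrow> Q \<omega>" for Q
    using typical_quasi_sure[OF countable] that unfolding quasi_surely_def by blast
  show ?thesis
    unfolding partial_sum_def[symmetric]
  proof (intro conjI impI allI; rule qs)
    fix \<omega> assume \<omega>: "\<omega> \<in> typical D"
    show "(\<lambda>n. dist_l1 ((1 / real n) *\<^sub>R partial_sum n \<omega>) (Gamma_star H Ehat X)) \<longlonglongrightarrow> 0"
      by (rule typical_conclusions[OF \<omega> axes dense])
  next
    fix \<omega> assume \<omega>: "\<omega> \<in> typical D"
    show "\<forall>l. (\<exists>r. strict_mono r \<and> (\<lambda>m. (1 / real (r m)) *\<^sub>R partial_sum (r m) \<omega>) \<longlonglongrightarrow> l)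
        \<longrightarrow> l \<in> Gamma_star H Ehat X"
      using typical_limit_point[OF \<omega> _ _ dense] by blast
  next
    fix i \<omega> assume \<omega>: "\<omega> \<in> typical D"
    show "ereal (- Ehat (\<lambda>\<omega>'. - (X 1 \<omega>' $ i))) \<le> (INF x\<in>Gamma_star H Ehat X. ereal (x $ i)) \<and>
      (INF x\<in>Gamma_star H Ehat X. ereal (x $ i))
        \<le> liminf (\<lambda>n. ereal (((1 / real n) *\<^sub>R partial_sum n \<omega>) $ i)) \<and>
      liminf (\<lambda>n. ereal (((1 / real n) *\<^sub>R partial_sum n \<omega>) $ i))
        \<le> limsup (\<lambda>n. ereal (((1 / real n) *\<^sub>R partial_sum n \<omega>) $ i)) \<and>
      limsup (\<lambda>n. ereal (((1 / real n) *\<^sub>R partial_sum n \<omega>) $ i))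
        \<le> (SUP x\<in>Gamma_star H Ehat X. ereal (x $ i)) \<and>
      (SUP x\<in>Gamma_star H Ehat X. ereal (x $ i)) \<le> ereal (Ehat (\<lambda>\<omega>'. X 1 \<omega>' $ i))"
      using typical_conclusions(2,3)[OF \<omega> axes dense]
      by (auto intro!: INF_greatest SUP_least Gamma_star_bounds[simplified] Liminf_le_Limsup)
  qed
qed

end
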